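(* Let $q$ be a prime power and $M,N$ positive integers with $\min\{M,N\}>2$. Let $P$ be the first eigenmatrix of the association scheme of $M\times N$ bilinear forms over $\mathbb{F}_q$ (with respect to the standard self-dual ordering). Then there is no diagonal complex matrix $T$ with $(PT)^3=I$.
   Context: The bilinear forms scheme has point set the $M\times N$ matrices over $\mathbb{F}_q$, with $(A,B)\in R_i$ iff $\operatorname{rank}(A-B)=i$, $0\le i\le \min\{M,N\}$. It is a self-dual P-polynomial scheme; $P$ is the matrix with $(i,j)$ entry $P_j(i)$ where $A_j=\sum_i P_j(i)E_i$, the relations are ordered by rank and the primitive idempotents are ordered so that $P=Q$ (the Q-polynomial ordering); with $d=q^M$, $e=q^N$ this ordering gives $P_1(i)=\bigl(de\,q^{-i}+1-d-e\bigr)/(q-1)$. Its intersection numbers are $b_i=q^{2i}(dq^{-i}-1)(eq^{-i}-1)/(q-1)$, $c_i=q^{i-1}(q^i-1)/(q-1)$. For $T=\mathrm{diag}(T_0,\dots)$, $PT$ has $(i,j)$ entry $P_j(i)T_j$. *)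

theory Defs
  imports "HOL-Analysis.Analysis" "Jordan_Normal_Form.Matrix"
begin

no_notation vec_index (infixl \<open>$\<close> 100)

text \<open>
  Matrices indexed by the points of a scheme are of type \<open>complex^'x^'x\<close>, where \<open>'x\<close> is the
  (finite) type of points.  The eigenmatrices, indexed by \<open>0, \<dots>, D\<close>, are of type
  \<open>complex Matrix.mat\<close> and dimension \<open>(D + 1) \<times> (D + 1)\<close>.
\<close>

definition adjacency :: "('x::finite \<times> 'x) set \<Rightarrow> complex^'x^'x" where
  "adjacency r = (\<chi> x y. if (x, y) \<in> r then 1 else 0)"

definition lincomb :: "nat \<Rightarrow> (nat \<Rightarrow> complex) \<Rightarrow> (nat \<Rightarrow> complex^'x^'x) \<Rightarrow> complex^'x^'x" where
  "lincomb D c B = (\<chi> x y. \<Sum>i\<le>D. c i * B i $ x $ y)"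

definition bose_mesner :: "nat \<Rightarrow> (nat \<Rightarrow> ('x::finite \<times> 'x) set) \<Rightarrow> (complex^'x^'x) set" where
  "bose_mesner D R = range (\<lambda>c. lincomb D c (\<lambda>i. adjacency (R i)))"

definition primitive_idempotents :: "(complex^'x^'x) set \<Rightarrow> (complex^'x^'x) set" where
  "primitive_idempotents \<A> = {E \<in> \<A>. E \<noteq> 0 \<and> E ** E = E \<and>
     \<not> (\<exists>F\<in>\<A>. \<exists>G\<in>\<A>. F \<noteq> 0 \<and> G \<noteq> 0 \<and> F ** F = F \<and> G ** G = G \<and>
          F ** G = 0 \<and> G ** F = 0 \<and> E = F + G)}"

definition idempotent_ordering ::
    "nat \<Rightarrow> (nat \<Rightarrow> ('x::finite \<times> 'x) set) \<Rightarrow> (nat \<Rightarrow> complex^'x^'x) \<Rightarrow> bool" where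
  "idempotent_ordering D R E \<longleftrightarrow> bij_betw E {..D} (primitive_idempotents (bose_mesner D R))"

text \<open>\<open>A\<^sub>j = (\<Sum>i\<le>D. P\<^sub>j(i) E\<^sub>i)\<close>, where \<open>P\<^sub>j(i)\<close> is the \<open>(i, j)\<close> entry of \<open>P\<close>.\<close>

definition first_eigenmatrix ::
    "nat \<Rightarrow> (nat \<Rightarrow> ('x::finite \<times> 'x) set) \<Rightarrow> (nat \<Rightarrow> complex^'x^'x) \<Rightarrow> complex Matrix.mat \<Rightarrow> bool" where
  "first_eigenmatrix D R E P \<longleftrightarrow> P \<in> carrier_mat (D + 1) (D + 1) \<and>
     (\<forall>j\<le>D. adjacency (R j) = lincomb D (\<lambda>i. P $$ (i, j)) E)"

text \<open>\<open>E\<^sub>j = |X|\<^sup>-\<^sup>1 (\<Sum>i\<le>D. Q\<^sub>j(i) A\<^sub>i)\<close>, where \<open>Q\<^sub>j(i)\<close> is the \<open>(i, j)\<close> entry of \<open>Q\<close>.\<close>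

definition second_eigenmatrix ::
    "nat \<Rightarrow> (nat \<Rightarrow> ('x::finite \<times> 'x) set) \<Rightarrow> (nat \<Rightarrow> complex^'x^'x) \<Rightarrow> complex Matrix.mat \<Rightarrow> bool" where
  "second_eigenmatrix D R E Q \<longleftrightarrow> Q \<in> carrier_mat (D + 1) (D + 1) \<and>
     (\<forall>j\<le>D. E j = lincomb D (\<lambda>i. Q $$ (i, j) / of_nat CARD('x)) (\<lambda>i. adjacency (R i)))"

text \<open>
  The ordering \<open>E\<close> of the primitive idempotents is self-dual if the two eigenmatrices with
  respect to it coincide.  For the bilinear forms scheme below with \<open>D > 2\<close>, this determines \<open>E\<close>:
  it forces the multiplicity of \<open>E\<^sub>i\<close> to be the valency of the \<open>i\<close>-th relation, and these
  valencies are pairwise distinct.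
\<close>

definition self_dual_eigenmatrix ::
    "nat \<Rightarrow> (nat \<Rightarrow> ('x::finite \<times> 'x) set) \<Rightarrow> (nat \<Rightarrow> complex^'x^'x) \<Rightarrow> complex Matrix.mat \<Rightarrow> bool" where
  "self_dual_eigenmatrix D R E P \<longleftrightarrow>
     idempotent_ordering D R E \<and> first_eigenmatrix D R E P \<and> second_eigenmatrix D R E P"

text \<open>
  The points are the matrices with \<open>CARD('m)\<close> rows and \<open>CARD('n)\<close> columns over the finite
  field \<open>'f\<close>.
\<close>

definition bilinear_rel :: "nat \<Rightarrow> (('f::{field,finite}^'n^'m) \<times> ('f^'n^'m)) set" where
  "bilinear_rel i = {(A, B). rank (A - B) = i}"

end

theory Submission
  imports Defs
begin

text \<open>
  Let \<open>L\<close> be the tridiagonal matrix of the intersection numbers \<open>p\<^sup>i\<^sub>1\<^sub>j\<close>, with entries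
  \<open>c\<^sub>i, a\<^sub>i, b\<^sub>i\<close>. Counting rank-one perturbations of a matrix of rank \<open>i\<close> gives these
  numbers, and self-duality gives \<open>P\<^sup>2 = n I\<close> and \<open>P L = \<theta> P\<close>, \<open>L P = P \<theta>\<close> with \<open>\<theta>\<close> the diagonal
  matrix of the entries \<open>P\<^sub>1(i)\<close>. The sequence of the expected eigenvalues is an eigenvector of
  \<open>L\<close>, so up to scaling it is a column \<open>m\<close> of \<open>P\<close>; its norm forces the \<open>m\<close>-th valency to be the
  first one, and a \<open>q\<close>-adic argument then forces \<open>m = 1\<close>.

  If \<open>(P T)\<^sup>3 = I\<close>, then \<open>T\<^sup>-\<^sup>1 P T\<^sup>-\<^sup>1\<close> and \<open>T P T\<close> commute with \<open>L\<close>. With \<open>x\<^sub>i = T\<^sub>i\<^sub>+\<^sub>1 / T\<^sub>i\<close>, the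
  entries \<open>(1, 0)\<close> of the two commutation relations give \<open>x\<^sub>1 - 1 / x\<^sub>1 = (x\<^sub>0 - 1 / x\<^sub>0) / q\<close>.
  The Askey-Wilson relation of \<open>(\<theta>, L)\<close> is transported by a conjugation to the pair \<open>L\<close>,
  \<open>T\<^sup>-\<^sup>1 L T\<close> of tridiagonal matrices; its corner entries \<open>(0, 3)\<close> and \<open>(3, 0)\<close>, which exist because
  \<open>min {M, N} > 2\<close>, give \<open>x\<^sub>0 + x\<^sub>2 = (q + 1 / q) x\<^sub>1\<close> and the same for the inverses. Hence
  \<open>x\<^sub>1 = q x\<^sub>0\<close> or \<open>x\<^sub>0 = q x\<^sub>1\<close>, and both contradict the first equation.
\<close>

section \<open>Linear algebra over a finite field\<close>

lemma card_fiber_eq: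
  fixes f :: "'a::ab_group_add \<Rightarrow> 'b::ab_group_add"
  assumes "w \<in> W"
    and "\<And>x y. x \<in> W \<Longrightarrow> y \<in> W \<Longrightarrow> x + y \<in> W" and "\<And>x y. x \<in> W \<Longrightarrow> y \<in> W \<Longrightarrow> x - y \<in> W"
    and "\<And>x y. f (x + y) = f x + f y"
  shows "card {x \<in> W. f x = f w} = card {x \<in> W. f x = 0}"
proof -
  interpret additive f using assms(4) by unfold_locales
  show ?thesis
    by (rule bij_betw_same_card[of "\<lambda>x. x - w"], rule bij_betwI[where g = "\<lambda>x. x + w"])
      (auto simp: diff add assms(1-3))
qed

lemma card_eq_card_image_mult_kernel:
  fixes f :: "'a::ab_group_add \<Rightarrow> 'b::ab_group_add"
  assumes "finite W"
    and "\<And>x y. x \<in> W \<Longrightarrow> y \<in> W \<Longrightarrow> x + y \<in> W" and "\<And>x y. x \<in> W \<Longrightarrow> y \<in> W \<Longrightarrow> x - y \<in> W"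
    and "\<And>x y. f (x + y) = f x + f y"
  shows "card W = card (f ` W) * card {x \<in> W. f x = 0}"
proof -
  have "card W = (\<Sum>y\<in>f ` W. card {x \<in> W. f x = y})"
    using sum.image_gen[OF assms(1), of "\<lambda>_. 1::nat" f] by simp
  also have "\<dots> = (\<Sum>y\<in>f ` W. card {x \<in> W. f x = 0})"
    by (rule sum.cong) (use card_fiber_eq[of _ W f] assms in auto)
  finally show ?thesis by simp
qed

section \<open>The standard bilinear form and annihilators\<close>

definition dot :: "'f::field^'n \<Rightarrow> 'f^'n \<Rightarrow> 'f" where
  "dot v w = (\<Sum>j\<in>UNIV. v $ j * w $ j)"

lemma dot_add_right: "dot v (w + w') = dot v w + dot v w'"
  and dot_diff_right: "dot v (w - w') = dot v w - dot v w'"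
  and dot_scale_right: "dot v (c *s w) = c * dot v w"
  and dot_zero_right [simp]: "dot v 0 = 0"
  and dot_commute: "dot v w = dot w v"
  and dot_axis: "dot v (axis j 1) = v $ j"
  by (simp_all add: dot_def algebra_simps sum.distrib sum_subtractf sum_distrib_left axis_def
      if_distrib cong: if_cong)

lemma dot_add_left: "dot (v + v') w = dot v w + dot v' w"
  and dot_zero_left [simp]: "dot 0 w = 0"
  and dot_scale_left: "dot (c *s v) w = c * dot v w"
  by (simp_all add: dot_commute[of _ w] dot_add_right dot_scale_right)

lemma dot_eq_zero_iff: "(\<forall>w. dot v w = 0) \<longleftrightarrow> v = 0"
proof
  assume "\<forall>w. dot v w = 0"
  then have "v $ j = 0" for j by (metis dot_axis)
  then show "v = 0" by (simp add: Finite_Cartesian_Product.vec_eq_iff)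
qed simp

definition annihilator :: "('f::field^'n) set \<Rightarrow> ('f^'n) set" where
  "annihilator W = {v. \<forall>w\<in>W. dot v w = 0}"

lemma subspace_annihilator: "vec.subspace (annihilator W)"
  by (auto simp: vec.subspace_def annihilator_def dot_add_left dot_scale_left)

text \<open>Scaling \<open>w\<close> shows that \<open>\<phi>\<close> maps \<open>W\<close> onto the
  field; its fibers are then nonempty cosets of one kernel, so all have the same size.\<close>

lemma card_functional_fiber:
  fixes \<phi> :: "'f::{field,finite}^'n \<Rightarrow> 'f"
  assumes W: "vec.subspace W" and add: "\<And>x y. \<phi> (x + y) = \<phi> x + \<phi> y"
    and scale: "\<And>c x. \<phi> (c *s x) = c * \<phi> x" and "w \<in> W" "\<phi> w \<noteq> 0"
  shows "CARD('f) * card {x \<in> W. \<phi> x = c} = card W"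
proof -
  have surj: "\<exists>x\<in>W. \<phi> x = a" for a
    using assms(4,5) scale[of "a / \<phi> w" w] vec.subspace_scale[OF W, of w] by force
  have "\<phi> ` W = UNIV" using surj by (auto simp: image_iff) metis
  moreover obtain x where "x \<in> W" "\<phi> x = c" using surj by blast
  moreover have "card W = card (\<phi> ` W) * card {x \<in> W. \<phi> x = 0}"
    by (rule card_eq_card_image_mult_kernel)
      (use W add in \<open>auto intro: vec.subspace_add vec.subspace_diff\<close>)
  moreover have "card {x \<in> W. \<phi> x = c} = card {x \<in> W. \<phi> x = 0}"
    using card_fiber_eq[of x W \<phi>, OF _ vec.subspace_add[OF W] vec.subspace_diff[OF W] add]
      calculation(2,3) by simp
  ultimately show ?thesis by simp
qed

text \<open>Double counting of the orthogonal pairs in \<open>F\<^sup>n \<times> W\<close>.\<close>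

lemma card_annihilator:
  fixes W :: "('f::{field,finite}^'n) set"
  assumes W: "vec.subspace W"
  shows "card (annihilator W) * card W = CARD('f) ^ CARD('n)"
proof -
  let ?q = "int CARD('f)" and ?A = "annihilator W"
  let ?V = "UNIV :: ('f^'n) set"
  have q1: "?q > 1"
    using card_mono[of UNIV "{0, 1 :: 'f}"] by simp
  have V: "card ?V = CARD('f) ^ CARD('n)" by simp
  \<comment> \<open>Multiplying by \<open>?q\<close> avoids division: a nonzero vector is orthogonal
    to one \<open>?q\<close>-th of the space. Integers allow the factor \<open>?q - 1\<close> to be
    split off at the end.\<close>
  have left: "?q * int (card {v. dot v w = 0}) = (if w = 0 then ?q * card ?V else card ?V)" for w :: "'f^'n"
  proof (cases "w = 0")
    case False
    then obtain v where "dot v w \<noteq> 0" using dot_eq_zero_iff[of w] by (metis dot_commute)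
    then have "CARD('f) * card {v \<in> ?V. dot v w = 0} = card ?V"
      by (intro card_functional_fiber[where w = v]) (auto simp: dot_add_left dot_scale_left)
    then show ?thesis using False by (simp flip: of_nat_mult)
  qed simp
  have right: "?q * int (card {w \<in> W. dot v w = 0}) = (if v \<in> ?A then ?q * card W else card W)" for v
  proof (cases "v \<in> ?A")
    case True
    then have "{w \<in> W. dot v w = 0} = W" by (auto simp: annihilator_def)
    then show ?thesis using True by simp
  next
    case False
    then obtain w where "w \<in> W" "dot v w \<noteq> 0" by (auto simp: annihilator_def)
    then have "CARD('f) * card {w \<in> W. dot v w = 0} = card W"
      by (intro card_functional_fiber[where w = w]) (auto simp: W dot_add_right dot_scale_right)
    then show ?thesis using False by (simp flip: of_nat_mult)
  qed
  have "(\<Sum>w\<in>W. card {v \<in> ?V. dot v w = 0}) = (\<Sum>v\<in>?V. card {w \<in> W. dot v w = 0})"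
    using sum.swap_restrict[of W ?V "\<lambda>_ _. 1::nat" "\<lambda>w v. dot v w = 0"] by simp
  then have "(\<Sum>w\<in>W. ?q * int (card {v. dot v w = 0})) = (\<Sum>v\<in>?V. ?q * int (card {w \<in> W. dot v w = 0}))"
    by (simp flip: sum_distrib_left of_nat_sum)
  then have "(\<Sum>w\<in>W. if w = 0 then ?q * card ?V else card ?V)
      = (\<Sum>v\<in>?V. if v \<in> ?A then ?q * card W else card W)"
    by (simp only: left right)
  moreover have "(\<Sum>w\<in>W. if w = 0 then ?q * card ?V else card ?V)
      = (\<Sum>w\<in>W. int (card ?V) + (if w = 0 then (?q - 1) * card ?V else 0))"
    by (rule sum.cong) (auto simp: algebra_simps)
  moreover have "(\<Sum>v\<in>?V. if v \<in> ?A then ?q * card W else card W)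
      = (\<Sum>v\<in>?V. int (card W) + (if v \<in> ?A then (?q - 1) * card W else 0))"
    by (rule sum.cong) (auto simp: algebra_simps)
  ultimately have "(?q - 1) * card ?V = (?q - 1) * (card ?A * card W)"
    using vec.subspace_0[OF W] by (simp add: sum.distrib sum.If_cases algebra_simps del: CARD_vec)
  then have "int (card ?V) = int (card ?A * card W)" using q1 by simp
  then show ?thesis using V by linarith
qed

text \<open>Adjoining \<open>b\<close> multiplies the size by that of the field, because each new
  element is \<open>c *s b + x\<close> for a unique pair with \<open>x\<close> in the old
  span.\<close>

lemma card_span_independent:
  fixes B :: "('f::{field,finite}^'n) set"
  assumes "vec.independent B"
  shows "card (vec.span B) = CARD('f) ^ card B"
  using finite[of B] assms
proof (induction B rule: finite_induct)
  case (insert b B)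
  have b: "b \<notin> vec.span B" and ind: "vec.independent B"
    using insert.prems insert.hyps by (auto simp: vec.independent_insert)
  have "vec.span (insert b B) = (\<lambda>(c, x). c *s b + x) ` (UNIV \<times> vec.span B)"
  proof (intro equalityI subsetI)
    fix y assume "y \<in> vec.span (insert b B)"
    then obtain k where "y - k *s b \<in> vec.span B" using vec.span_insert[of b B] by auto
    then show "y \<in> (\<lambda>(c, x). c *s b + x) ` (UNIV \<times> vec.span B)"
      by (intro image_eqI[of _ _ "(k, y - k *s b)"]) auto
  next
    fix y assume "y \<in> (\<lambda>(c, x). c *s b + x) ` (UNIV \<times> vec.span B)"
    then obtain k x where "y = k *s b + x" "x \<in> vec.span B" by auto
    then have "y - k *s b \<in> vec.span B" by simp
    then show "y \<in> vec.span (insert b B)" using vec.span_insert[of b B] by blast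
  qed
  moreover have "inj_on (\<lambda>(c, x). c *s b + x) (UNIV \<times> vec.span B)"
  proof (rule inj_onI, clarsimp)
    fix c x c' x' assume x: "x \<in> vec.span B" "x' \<in> vec.span B" and eq: "c *s b + x = c' *s b + x'"
    have "(c - c') *s b = x' - x" using eq by (simp add: vec.scale_left_diff_distrib algebra_simps)
    then have *: "(c - c') *s b \<in> vec.span B" using x vec.span_diff by metis
    have "c = c'"
    proof (rule ccontr)
      assume "c \<noteq> c'"
      then have "b = inverse (c - c') *s ((c - c') *s b)" by (simp del: vec.scale_left_diff_distrib vector_sub_rdistrib)
      with * b show False using vec.span_scale by metis
    qed
    with eq show "c = c' \<and> x = x'" by simp
  qed
  ultimately have "card (vec.span (insert b B)) = CARD('f) * card (vec.span B)"
    by (simp add: card_image card_cartesian_product)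
  then show ?case using insert ind by simp
qed simp

lemma card_span:
  fixes S :: "('f::{field,finite}^'n) set"
  shows "card (vec.span S) = CARD('f) ^ vec.dim S"
proof -
  obtain B where "B \<subseteq> S" "vec.independent B" "S \<subseteq> vec.span B" "card B = vec.dim S"
    using vec.basis_exists by blast
  then show ?thesis
    using card_span_independent[of B] by (metis vec.span_mono vec.span_span subset_antisym)
qed

section \<open>Kernel, range and row space as sets of known size\<close>

definition right_kernel :: "'f::field^'n^'m \<Rightarrow> ('f^'n) set" where
  "right_kernel B = {w. B *v w = 0}"

lemma subspace_right_kernel: "vec.subspace (right_kernel B)"
  by (auto simp: vec.subspace_def right_kernel_def matrix_vector_right_distrib vector_scalar_commute)

lemma kernel_eq_annihilator_rows: "right_kernel B = annihilator (vec.span (Finite_Cartesian_Product.rows B))"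
proof -
  have "dot w (Finite_Cartesian_Product.row i B) = (B *v w) $ i" for w i
    by (simp add: dot_def Finite_Cartesian_Product.row_def matrix_vector_mult_def mult.commute)
  then have "B *v w = 0 \<longleftrightarrow> Finite_Cartesian_Product.rows B \<subseteq> {v. dot w v = 0}" for w
    by (auto simp: Finite_Cartesian_Product.rows_def Finite_Cartesian_Product.vec_eq_iff[of "B *v w"])
  moreover have "vec.subspace {v. dot w v = 0}" for w :: "'a^'b"
    by (auto simp: vec.subspace_def dot_add_right dot_scale_right)
  ultimately have "B *v w = 0 \<longleftrightarrow> vec.span (Finite_Cartesian_Product.rows B) \<subseteq> {v. dot w v = 0}" for w
    by (meson vec.span_minimal vec.span_superset subset_trans)
  then show ?thesis
    by (auto simp: right_kernel_def annihilator_def)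
qed

text \<open>Rank-nullity in counting form: the kernel annihilates the row space, whose dimension is
  the rank.\<close>

lemma card_right_kernel:
  fixes B :: "'f::{field,finite}^'n^'m"
  shows "card (right_kernel B) * CARD('f) ^ rank B = CARD('f) ^ CARD('n)"
  using card_annihilator[of "vec.span (Finite_Cartesian_Product.rows B)"]
  by (simp add: kernel_eq_annihilator_rows card_span row_rank_def_gen)

lemma card_range:
  fixes B :: "'f::{field,finite}^'n^'m"
  shows "card (range ((*v) B)) = CARD('f) ^ rank B"
proof -
  have "CARD('f^'n) = card (range ((*v) B)) * card {x \<in> UNIV. B *v x = 0}"
    by (rule card_eq_card_image_mult_kernel) (auto simp: matrix_vector_right_distrib)
  moreover have "card (right_kernel B) \<noteq> 0"
    using vec.subspace_0[OF subspace_right_kernel] by (metis card_0_eq empty_iff finite)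
  moreover have "card (right_kernel B) * CARD('f) ^ rank B = CARD('f^'n)"
    using card_right_kernel[of B] by simp
  ultimately have "card (right_kernel B) * card (range ((*v) B)) = card (right_kernel B) * CARD('f) ^ rank B"
    unfolding right_kernel_def by (simp only: UNIV_I simp_thms mult.commute)
  with \<open>card (right_kernel B) \<noteq> 0\<close> show ?thesis by simp
qed

text \<open>This annihilator is the row space of \<open>B\<close>. It plays for the right factor
  \<open>v\<close> of \<open>outer u v\<close> the role that the range plays for the left factor
  \<open>u\<close>.\<close>

lemma card_annihilator_kernel:
  fixes B :: "'f::{field,finite}^'n^'m"
  shows "card (annihilator (right_kernel B)) = CARD('f) ^ rank B"
proof -
  have "card (right_kernel B) \<noteq> 0"
    using vec.subspace_0[OF subspace_right_kernel] by (metis card_0_eq empty_iff finite)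
  then show ?thesis
    using card_right_kernel[of B] card_annihilator[OF subspace_right_kernel, of B]
    by (metis mult.commute mult_left_cancel)
qed

section \<open>Rank-one perturbations\<close>

lemma card_field_gt_one: "CARD('f::{field,finite}) > 1"
  using card_mono[of UNIV "{0, 1 :: 'f}"] by simp

text \<open>The kernel size determines the rank, so each rank computation below reduces to comparing
  kernels.\<close>

lemma rank_eqI:
  fixes B :: "'f::{field,finite}^'n^'m"
  assumes "card (right_kernel B) * CARD('f) ^ r = CARD('f) ^ CARD('n)"
  shows "rank B = r"
proof -
  have "card (right_kernel B) \<noteq> 0" using assms by auto
  moreover have "card (right_kernel B) * CARD('f) ^ rank B = card (right_kernel B) * CARD('f) ^ r"
    using assms card_right_kernel[of B] by simp
  ultimately show ?thesis
    using card_field_gt_one[where 'f = 'f] power_inject_exp by (metis mult_left_cancel)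
qed

lemma rank_le_min:
  fixes B :: "'f::{field,finite}^'n^'m"
  shows "rank B \<le> min CARD('m) CARD('n)"
proof -
  have "CARD('f) ^ rank B \<le> CARD('f) ^ CARD('m)"
    using card_mono[of UNIV "range ((*v) B)"] card_range[of B] by simp
  moreover have "CARD('f) ^ rank B \<le> CARD('f) ^ CARD('n)"
    using card_mono[of UNIV "annihilator (right_kernel B)"] card_annihilator_kernel[of B] by simp
  ultimately show ?thesis
    using card_field_gt_one[where 'f = 'f] by simp
qed

lemma matrix_vector_mult_uminus: "(- B) *v w = - (B *v (w :: 'f::field^'n))"
  by (simp add: Finite_Cartesian_Product.vec_eq_iff matrix_vector_mult_def sum_negf)

lemma rank_uminus: "rank (- B) = rank (B :: 'f::{field,finite}^'n^'m)"
  by (rule rank_eqI) (use card_right_kernel[of B] in \<open>simp add: right_kernel_def matrix_vector_mult_uminus\<close>)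

lemma rank_eq_zero_iff:
  fixes B :: "'f::{field,finite}^'n^'m"
  shows "rank B = 0 \<longleftrightarrow> B = 0"
proof
  assume "rank B = 0"
  then have "card (range ((*v) B)) = 1" using card_range[of B] by simp
  then obtain x where x: "range ((*v) B) = {x}" by (auto simp: card_1_singleton_iff)
  then have "B *v w = B *v 0" for w by (metis rangeI singletonD)
  then have "B *v w = 0 *v w" for w by simp
  then show "B = 0" unfolding matrix_eq by blast
next
  assume "B = 0"
  then show "rank B = 0" by (intro rank_eqI) (simp add: right_kernel_def)
qed

definition outer :: "'f::field^'m \<Rightarrow> 'f^'n \<Rightarrow> 'f^'n^'m" where
  "outer u v = (\<chi> i j. u $ i * v $ j)"

lemma outer_mult_vector: "outer u v *v w = dot v w *s u"
  by (simp add: Finite_Cartesian_Product.vec_eq_iff outer_def matrix_vector_mult_def dot_def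
      sum_distrib_left mult_ac)

lemma mem_right_kernel: "w \<in> right_kernel B \<longleftrightarrow> B *v w = 0"
  by (simp add: right_kernel_def)

lemma mem_kernel_update: "w \<in> right_kernel (B + outer u v) \<longleftrightarrow> B *v w + dot v w *s u = 0"
  by (simp add: right_kernel_def matrix_vector_mult_add_rdistrib outer_mult_vector)

text \<open>A kernel vector \<open>w\<close> with \<open>dot v w\<close> nonzero could be rescaled
  to a preimage of \<open>u\<close>.\<close>

lemma kernel_update_not_range:
  assumes "u \<notin> range ((*v) B)"
  shows "right_kernel (B + outer u v) = {w \<in> right_kernel B. dot v w = 0}"
proof -
  have "dot v w = 0" if "B *v w + dot v w *s u = 0" for w
  proof (rule ccontr)
    assume *: "dot v w \<noteq> 0"
    have "B *v ((- inverse (dot v w)) *s w) = (- inverse (dot v w)) *s (B *v w)"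
      by (simp only: vector_scalar_commute)
    also have "B *v w = (- dot v w) *s u" using that by (simp add: eq_neg_iff_add_eq_0)
    finally have "B *v ((- inverse (dot v w)) *s w) = u" using * by simp
    with assms show False by (metis rangeI)
  qed
  then have "B *v w + dot v w *s u = 0 \<longleftrightarrow> B *v w = 0 \<and> dot v w = 0" for w
    by (metis add.right_neutral vector_smult_lzero)
  then show ?thesis by (simp add: set_eq_iff mem_kernel_update mem_right_kernel[of _ B])
qed

context
  fixes B :: "'f::{field,finite}^'n^'m" and u :: "'f^'m" and v :: "'f^'n"
begin

lemma rank_update_Suc:
  assumes "u \<notin> range ((*v) B)" "v \<notin> annihilator (right_kernel B)"
  shows "rank (B + outer u v) = Suc (rank B)"
proof (rule rank_eqI)
  obtain w where "w \<in> right_kernel B" "dot v w \<noteq> 0" using assms(2) by (auto simp: annihilator_def)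
  then have "CARD('f) * card {w \<in> right_kernel B. dot v w = 0} = card (right_kernel B)"
    by (intro card_functional_fiber) (auto simp: subspace_right_kernel dot_add_right dot_scale_right)
  then show "card (right_kernel (B + outer u v)) * CARD('f) ^ Suc (rank B) = CARD('f) ^ CARD('n)"
    using card_right_kernel[of B]
    by (metis kernel_update_not_range[OF assms(1)] mult.assoc mult.commute power_Suc)
qed

lemma rank_update_eq_if_not_range:
  assumes "u \<notin> range ((*v) B)" "v \<in> annihilator (right_kernel B)"
  shows "rank (B + outer u v) = rank B"
proof (rule rank_eqI)
  have "{w \<in> right_kernel B. dot v w = 0} = right_kernel B"
    using assms(2) by (auto simp: annihilator_def)
  then show "card (right_kernel (B + outer u v)) * CARD('f) ^ rank B = CARD('f) ^ CARD('n)"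
    using card_right_kernel[of B] by (simp add: kernel_update_not_range[OF assms(1)])
qed

lemma rank_update_eq_if_not_annihilator:
  assumes "u \<in> range ((*v) B)" "v \<notin> annihilator (right_kernel B)"
  shows "rank (B + outer u v) = rank B"
proof (rule rank_eqI)
  obtain w where w: "u = B *v w" using assms(1) by blast
  obtain k where k: "B *v k = 0" "dot v k \<noteq> 0"
    using assms(2) by (auto simp: annihilator_def right_kernel_def)
  \<comment> \<open>A preimage of \<open>u\<close>, corrected by a kernel vector so that it is
    orthogonal to \<open>v\<close>; the shear along \<open>w0\<close> then maps one kernel onto the
    other.\<close>
  define w0 where "w0 = w - (dot v w / dot v k) *s k"
  have w0: "B *v w0 = u" "dot v w0 = 0"
    using k w by (auto simp: w0_def matrix_vector_mult_diff_distrib vector_scalar_commute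
        dot_diff_right dot_scale_right)
  have "bij_betw (\<lambda>x. x + dot v x *s w0) (right_kernel (B + outer u v)) (right_kernel B)"
    by (rule bij_betwI[where g = "\<lambda>x. x - dot v x *s w0"])
      (auto simp: mem_kernel_update w0 dot_add_right dot_diff_right dot_scale_right mem_right_kernel[of _ B]
        matrix_vector_right_distrib matrix_vector_mult_diff_distrib vector_scalar_commute)
  then show "card (right_kernel (B + outer u v)) * CARD('f) ^ rank B = CARD('f) ^ CARD('n)"
    using card_right_kernel[of B] by (simp add: bij_betw_same_card)
qed

text \<open>If \<open>w\<close> lies in the new kernel, then \<open>w + dot v w *s w0\<close> lies
  in the old one. Applying \<open>v\<close> gives \<open>dot v w * (1 + dot v w0) = 0\<close>, so
  the kernel is unchanged unless \<open>dot v w0 = -1\<close>.\<close>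

lemma rank_update_eq_if_dot_neq:
  assumes "u = B *v w0" "v \<in> annihilator (right_kernel B)" "dot v w0 \<noteq> -1"
  shows "rank (B + outer u v) = rank B"
proof (rule rank_eqI)
  have "dot v w = 0" if "B *v w + dot v w *s u = 0" for w
  proof -
    have "w + dot v w *s w0 \<in> right_kernel B"
      using that by (simp add: right_kernel_def assms(1) matrix_vector_right_distrib vector_scalar_commute)
    then have "dot v (w + dot v w *s w0) = 0" using assms(2) by (auto simp: annihilator_def)
    then have "dot v w * (1 + dot v w0) = 0" by (simp add: dot_add_right dot_scale_right algebra_simps)
    moreover have "1 + dot v w0 \<noteq> 0" using assms(3) by (metis minus_unique)
    ultimately show ?thesis by simp
  qed
  then have "B *v w + dot v w *s u = 0 \<longleftrightarrow> B *v w = 0" for w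
    using assms(2) by (auto simp: annihilator_def mem_right_kernel) (metis add.right_neutral vector_smult_lzero)
  then have "right_kernel (B + outer u v) = right_kernel B"
    by (simp add: set_eq_iff mem_kernel_update mem_right_kernel[of _ B])
  then show "card (right_kernel (B + outer u v)) * CARD('f) ^ rank B = CARD('f) ^ CARD('n)"
    using card_right_kernel[of B] by simp
qed

text \<open>Now \<open>w0\<close> itself is a kernel vector of the update, and the old kernel is the
  hyperplane \<open>dot v w = 0\<close> in the new one.\<close>

lemma rank_update_pred:
  assumes "u = B *v w0" "v \<in> annihilator (right_kernel B)" "dot v w0 = -1"
  shows "Suc (rank (B + outer u v)) = rank B"
proof (rule rank_eqI[symmetric])
  let ?B = "B + outer u v"
  have "w0 \<in> right_kernel ?B" using assms by (simp add: mem_kernel_update)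
  then have "CARD('f) * card {w \<in> right_kernel ?B. dot v w = 0} = card (right_kernel ?B)"
    by (intro card_functional_fiber[where w = w0])
      (auto simp: subspace_right_kernel dot_add_right dot_scale_right assms(3))
  moreover have "{w \<in> right_kernel ?B. dot v w = 0} = right_kernel B"
    using assms(2) by (auto simp: mem_kernel_update annihilator_def mem_right_kernel[of _ B])
  ultimately show "card (right_kernel B) * CARD('f) ^ Suc (rank ?B) = CARD('f) ^ CARD('n)"
    using card_right_kernel[of ?B] by (metis mult.assoc mult.commute power_Suc)
qed

text \<open>The five preceding cases are exhaustive, and only the first of them raises the
  rank.\<close>

lemma rank_update_eq_Suc_iff:
  "rank (B + outer u v) = Suc (rank B) \<longleftrightarrow>
     u \<notin> range ((*v) B) \<and> v \<notin> annihilator (right_kernel B)"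
  using rank_update_Suc rank_update_eq_if_not_range rank_update_eq_if_not_annihilator rank_update_eq_if_dot_neq rank_update_pred
  by (metis Suc_n_not_le_n imageE le_SucI n_not_Suc_n order_refl)

lemma rank_update_eq_pred_iff:
  "Suc (rank (B + outer u v)) = rank B \<longleftrightarrow>
     (\<exists>w0. u = B *v w0 \<and> v \<in> annihilator (right_kernel B) \<and> dot v w0 = -1)"
  using rank_update_Suc rank_update_eq_if_not_range rank_update_eq_if_not_annihilator rank_update_eq_if_dot_neq rank_update_pred
  by (metis Suc_n_not_le_n imageE le_SucI n_not_Suc_n order_refl)

lemma rank_update_cases:
  "rank (B + outer u v) = Suc (rank B) \<or> rank (B + outer u v) = rank B \<or>
     Suc (rank (B + outer u v)) = rank B"
  using rank_update_Suc rank_update_eq_if_not_range rank_update_eq_if_not_annihilator rank_update_eq_if_dot_neq rank_update_pred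
  by (metis imageE)

end

lemma outer_eq_iff:
  fixes u u' :: "'f::field^'m" and v v' :: "'f^'n"
  assumes "u \<noteq> 0" "v \<noteq> 0"
  shows "outer u' v' = outer u v \<longleftrightarrow> (\<exists>c. c \<noteq> 0 \<and> u' = c *s u \<and> v' = inverse c *s v)"
proof
  assume "outer u' v' = outer u v"
  then have eq: "u' $ i * v' $ j = u $ i * v $ j" for i j
    by (simp add: outer_def Finite_Cartesian_Product.vec_eq_iff)
  obtain i where i: "u $ i \<noteq> 0" using assms(1) by (auto simp: Finite_Cartesian_Product.vec_eq_iff)
  obtain j where j: "v $ j \<noteq> 0" using assms(2) by (auto simp: Finite_Cartesian_Product.vec_eq_iff)
  have nz: "u' $ i \<noteq> 0" "v' $ j \<noteq> 0" using eq[of i j] i j by auto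
  define c where "c = u' $ i / u $ i"
  have "u' $ k = c * u $ k" for k
  proof -
    have "(u' $ k * v' $ j) * (u $ i * v $ j) = (u $ k * v $ j) * (u' $ i * v' $ j)"
      by (simp only: eq)
    then have "(u' $ k * u $ i) * (v' $ j * v $ j) = (u' $ i * u $ k) * (v' $ j * v $ j)"
      by (simp only: mult_ac)
    then show ?thesis using i j nz by (simp add: c_def field_simps)
  qed
  moreover have "v' $ k = inverse c * v $ k" for k
    using eq[of i k] i nz by (simp add: c_def field_simps)
  moreover have "c \<noteq> 0" using i nz by (simp add: c_def)
  ultimately show "\<exists>c. c \<noteq> 0 \<and> u' = c *s u \<and> v' = inverse c *s v"
    by (intro exI[of _ c]) (simp add: Finite_Cartesian_Product.vec_eq_iff)
qed (auto simp: outer_def Finite_Cartesian_Product.vec_eq_iff)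

text \<open>A range of the size of the field is the line through any nonzero \<open>Z *v w\<close>,
  and all columns of \<open>Z\<close> lie on it. The converse is a rank-raising update of the zero
  matrix.\<close>

lemma rank_eq_one_iff:
  fixes Z :: "'f::{field,finite}^'n^'m"
  shows "rank Z = 1 \<longleftrightarrow> (\<exists>u v. u \<noteq> 0 \<and> v \<noteq> 0 \<and> Z = outer u v)"
proof
  assume r: "rank Z = 1"
  then have card: "card (range ((*v) Z)) = CARD('f)" by (simp add: card_range)
  obtain w where w: "Z *v w \<noteq> 0" using r rank_eq_zero_iff[of Z] by (auto simp: matrix_eq)
  define u where "u = Z *v w"
  have "inj (\<lambda>c. c *s u)" using w by (auto simp: inj_on_def u_def)
  then have "card (range (\<lambda>c. c *s u)) = CARD('f)" by (simp add: card_image)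
  moreover have "range (\<lambda>c. c *s u) \<subseteq> range ((*v) Z)"
    by (auto simp: u_def vector_scalar_commute[symmetric])
  ultimately have "range ((*v) Z) = range (\<lambda>c. c *s u)"
    using card by (metis card_subset_eq finite)
  then have "\<forall>j. \<exists>c. Z *v axis j 1 = c *s u" by blast
  then obtain v where "\<And>j. Z *v axis j 1 = v j *s u" by metis
  moreover have "(Z *v axis j 1) $ i = Z $ i $ j" for i j
    by (simp add: matrix_vector_mult_def axis_def if_distrib cong: if_cong)
  ultimately have "Z $ i $ j = u $ i * v j" for i j
    by (metis mult.commute vector_smult_component)
  then have Z: "Z = outer u (vec_lambda v)"
    by (simp add: outer_def Finite_Cartesian_Product.vec_eq_iff)
  then have "vec_lambda v \<noteq> 0" using w by (auto simp: outer_mult_vector)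
  then show "\<exists>u v. u \<noteq> 0 \<and> v \<noteq> 0 \<and> Z = outer u v"
    using Z w by (intro exI[of _ u] exI[of _ "vec_lambda v"]) (simp add: u_def)
next
  assume "\<exists>u v. u \<noteq> 0 \<and> v \<noteq> 0 \<and> Z = outer u v"
  then obtain u v where *: "u \<noteq> 0" "v \<noteq> 0" "Z = outer u v" by blast
  then have "rank ((0 :: 'f^'n^'m) + outer u v) = Suc (rank (0 :: 'f^'n^'m))"
    using dot_eq_zero_iff[of v]
    by (intro rank_update_Suc) (auto simp: annihilator_def right_kernel_def)
  then show "rank Z = 1" using * rank_eq_zero_iff[of "0 :: 'f^'n^'m"] by simp
qed

text \<open>Pairs of vectors are easier to count than matrices; the pairs giving a fixed rank-one
  matrix are \<open>(c *s u, inverse c *s v)\<close> with \<open>c\<close> nonzero.\<close>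

lemma card_rank_one:
  fixes Q :: "'f::{field,finite}^'n^'m \<Rightarrow> bool"
  shows "(CARD('f) - 1) * card {Z. rank Z = 1 \<and> Q Z} = card {(u, v). u \<noteq> 0 \<and> v \<noteq> 0 \<and> Q (outer u v)}"
proof -
  let ?S = "{(u, v). u \<noteq> 0 \<and> v \<noteq> 0 \<and> Q (outer u v)}" and ?f = "\<lambda>(u, v). outer u v"
  have img: "?f ` ?S = {Z. rank Z = 1 \<and> Q Z}" unfolding rank_eq_one_iff by (auto simp: image_iff)
  have "card {p \<in> ?S. ?f p = Z} = CARD('f) - 1" if Z: "Z \<in> ?f ` ?S" for Z
  proof -
    obtain u v where uv: "u \<noteq> 0" "v \<noteq> 0" "Q (outer u v)" "Z = outer u v" using Z by auto
    have "{p \<in> ?S. ?f p = Z} = (\<lambda>c. (c *s u, inverse c *s v)) ` (- {0})"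
      using uv outer_eq_iff[OF uv(1,2)] by (auto simp: image_iff) metis
    moreover have "inj_on (\<lambda>c. (c *s u, inverse c *s v)) (- {0})"
      using uv by (auto simp: inj_on_def)
    ultimately show ?thesis by (simp add: card_image Compl_eq_Diff_UNIV card_Diff_subset)
  qed
  moreover have "card ?S = (\<Sum>Z\<in>?f ` ?S. card {p \<in> ?S. ?f p = Z})"
    using sum.image_gen[of ?S "\<lambda>_. 1::nat" ?f] by simp
  ultimately show ?thesis unfolding img by simp
qed

lemma card_rank_one_total:
  "(CARD('f) - 1) * card {Z :: 'f::{field,finite}^'n^'m. rank Z = 1} =
     (CARD('f) ^ CARD('m) - 1) * (CARD('f) ^ CARD('n) - 1)"
proof -
  have "{(u, v). u \<noteq> 0 \<and> v \<noteq> 0} = (- {0 :: 'f^'m}) \<times> (- {0 :: 'f^'n})" by auto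
  then show ?thesis
    using card_rank_one[of "\<lambda>Z :: 'f^'n^'m. True"] by (simp add: card_cartesian_product Compl_eq_Diff_UNIV card_Diff_subset)
qed

lemma card_rank_one_Suc:
  fixes B :: "'f::{field,finite}^'n^'m"
  shows "(CARD('f) - 1) * card {Z. rank Z = 1 \<and> rank (B + Z) = Suc (rank B)} =
     (CARD('f) ^ CARD('m) - CARD('f) ^ rank B) * (CARD('f) ^ CARD('n) - CARD('f) ^ rank B)"
proof -
  have "{(u, v). u \<noteq> 0 \<and> v \<noteq> 0 \<and> rank (B + outer u v) = Suc (rank B)}
      = (- range ((*v) B)) \<times> (- annihilator (right_kernel B))"
    using vec.subspace_0[OF subspace_annihilator, of "right_kernel B"] rangeI[of "(*v) B" 0]
    by (auto simp: rank_update_eq_Suc_iff)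
  then show ?thesis
    unfolding card_rank_one by (simp add: card_cartesian_product Compl_eq_Diff_UNIV card_Diff_subset card_range card_annihilator_kernel)
qed

lemma double_annihilator:
  fixes W :: "('f::{field,finite}^'n) set"
  assumes "vec.subspace W"
  shows "annihilator (annihilator W) = W"
proof (rule card_subset_eq[symmetric])
  show "W \<subseteq> annihilator (annihilator W)" by (auto simp: annihilator_def dot_commute)
  have "card (annihilator W) \<noteq> 0"
    using vec.subspace_0[OF subspace_annihilator, of W] by auto
  moreover have "card (annihilator W) * card (annihilator (annihilator W)) = card (annihilator W) * card W"
    using card_annihilator[OF assms] card_annihilator[OF subspace_annihilator, of W]
    by (metis mult.commute)
  ultimately show "card W = card (annihilator (annihilator W))" by simp
qed simp

text \<open>Each nonzero \<open>u\<close> in the range admits the \<open>v\<close> of the row space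
  on which a preimage of \<open>u\<close> takes the value -1, one \<open>q\<close>-th of that space.
  The extra factor \<open>CARD('f)\<close> keeps the exponent \<open>rank B - 1\<close> out of the
  statement.\<close>

lemma card_rank_one_pred:
  fixes B :: "'f::{field,finite}^'n^'m"
  shows "CARD('f) * ((CARD('f) - 1) * card {Z. rank Z = 1 \<and> Suc (rank (B + Z)) = rank B}) =
     (CARD('f) ^ rank B - 1) * CARD('f) ^ rank B"
proof -
  let ?A = "annihilator (right_kernel B)" and ?R = "range ((*v) B)"
  \<comment> \<open>An arbitrary preimage of \<open>u\<close>; by \<open>indep\<close> its choice
    does not affect the value of any \<open>v\<close> in \<open>?A\<close>.\<close>
  define w0 where "w0 u = (SOME w. u = B *v w)" for u
  have w0: "B *v w0 u = u" if "u \<in> ?R" for u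
    using that unfolding w0_def by (metis (mono_tags, lifting) imageE someI_ex)
  have indep: "dot v w = dot v w'" if "v \<in> ?A" "B *v w = B *v w'" for v w w'
  proof -
    have "w - w' \<in> right_kernel B" using that(2) by (simp add: right_kernel_def matrix_vector_mult_diff_distrib)
    then have "dot v (w - w') = 0" using that(1) by (simp add: annihilator_def)
    then show ?thesis by (simp add: dot_diff_right)
  qed
  have "u \<noteq> 0 \<and> v \<noteq> 0 \<and> Suc (rank (B + outer u v)) = rank B \<longleftrightarrow>
      u \<in> ?R - {0} \<and> v \<in> ?A \<and> dot v (w0 u) = -1" for u v
  proof
    assume *: "u \<noteq> 0 \<and> v \<noteq> 0 \<and> Suc (rank (B + outer u v)) = rank B"
    then obtain w where w: "u = B *v w" "v \<in> ?A" "dot v w = -1"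
      unfolding rank_update_eq_pred_iff by blast
    moreover have "dot v (w0 u) = dot v w" using indep w w0 by blast
    ultimately show "u \<in> ?R - {0} \<and> v \<in> ?A \<and> dot v (w0 u) = -1" using * by simp
  next
    assume *: "u \<in> ?R - {0} \<and> v \<in> ?A \<and> dot v (w0 u) = -1"
    then have "u = B *v w0 u" "u \<noteq> 0" using w0 by simp_all
    moreover have "v \<noteq> 0" using * by auto
    ultimately show "u \<noteq> 0 \<and> v \<noteq> 0 \<and> Suc (rank (B + outer u v)) = rank B"
      unfolding rank_update_eq_pred_iff using * by blast
  qed
  then have "{(u, v). u \<noteq> 0 \<and> v \<noteq> 0 \<and> Suc (rank (B + outer u v)) = rank B}
      = Sigma (?R - {0}) (\<lambda>u. {v \<in> ?A. dot v (w0 u) = -1})" by auto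
  moreover have "CARD('f) * card {v \<in> ?A. dot v (w0 u) = -1} = CARD('f) ^ rank B" if "u \<in> ?R - {0}" for u
  proof -
    \<comment> \<open>Since \<open>u\<close> is nonzero, \<open>w0 u\<close> is outside the kernel,
      which is the double annihilator; hence some \<open>v\<close> in \<open>?A\<close> is nonzero
      there.\<close>
    have "w0 u \<notin> annihilator ?A"
      using w0[of u] that by (auto simp: double_annihilator[OF subspace_right_kernel] mem_right_kernel)
    then obtain v where "v \<in> ?A" "dot v (w0 u) \<noteq> 0" by (auto simp: annihilator_def dot_commute)
    then show ?thesis
      unfolding card_annihilator_kernel[of B, symmetric]
      by (intro card_functional_fiber[where w = v])
        (auto simp: subspace_annihilator dot_add_left dot_scale_left)
  qed
  moreover have "card (?R - {0}) = CARD('f) ^ rank B - 1"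
    using rangeI[of "(*v) B" 0] by (simp add: card_Diff_singleton card_range)
  ultimately show ?thesis
    unfolding card_rank_one by (simp add: sum_distrib_left)
qed

lemma rank_one_perturbation_cases:
  fixes B :: "'f::{field,finite}^'n^'m"
  assumes "rank Z = 1"
  shows "rank (B + Z) = Suc (rank B) \<or> rank (B + Z) = rank B \<or> Suc (rank (B + Z)) = rank B"
  using assms rank_update_cases unfolding rank_eq_one_iff by blast

section \<open>Self-dual P-polynomial schemes\<close>

text \<open>On a matrix type, \<open>*s\<close> takes its scalar from the row type, so
  multiplication by a complex number is given entrywise.\<close>

definition cscale :: "complex \<Rightarrow> complex^'x^'y \<Rightarrow> complex^'x^'y" where
  "cscale c X = (\<chi> x y. c * X $ x $ y)"

lemma cscale_add: "cscale c (X + Y) = cscale c X + cscale c Y"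
  and cscale_cscale: "cscale c (cscale c' X) = cscale (c * c') X"
  and cscale_one [simp]: "cscale 1 X = X"
  and cscale_zero [simp]: "cscale 0 X = 0"
  and cscale_zero_right [simp]: "cscale c 0 = 0"
  by (simp_all add: cscale_def Finite_Cartesian_Product.vec_eq_iff algebra_simps)

lemma cscale_sum: "cscale c (sum X I) = (\<Sum>i\<in>I. cscale c (X i))"
  by (induction I rule: infinite_finite_induct) (simp_all add: cscale_add)

lemma cscale_sum_left: "cscale (sum c I) X = (\<Sum>i\<in>I. cscale (c i) X)"
  by (simp add: cscale_def Finite_Cartesian_Product.vec_eq_iff sum_distrib_right)

lemma cscale_left_cancel: "X \<noteq> 0 \<Longrightarrow> cscale c X = cscale c' X \<longleftrightarrow> c = c'"
  by (auto simp: cscale_def Finite_Cartesian_Product.vec_eq_iff)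

lemma cscale_mult_left: "cscale c X ** Y = cscale c (X ** Y)"
  and cscale_mult_right: "X ** cscale c Y = cscale c (X ** Y)"
  by (simp_all add: cscale_def Finite_Cartesian_Product.vec_eq_iff matrix_matrix_mult_def
      sum_distrib_left mult_ac)

lemma matrix_mult_zero_left: "0 ** X = 0"
  and matrix_mult_zero_right: "X ** 0 = 0"
  by (simp_all add: Finite_Cartesian_Product.vec_eq_iff matrix_matrix_mult_def)

lemma matrix_add_rdistrib: "(X + Y) ** Z = X ** Z + Y ** (Z :: complex^'x^'y)"
  and matrix_diff_rdistrib: "(X - Y) ** Z = X ** Z - Y ** (Z :: complex^'x^'y)"
  and matrix_diff_ldistrib: "W ** (Z - Z') = W ** Z - W ** (Z' :: complex^'x^'y)"
  by (simp_all add: Finite_Cartesian_Product.vec_eq_iff matrix_matrix_mult_def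
      algebra_simps sum.distrib sum_subtractf)

lemma sum_matrix_mult: "sum X I ** (Y :: complex^'x^'y) = (\<Sum>i\<in>I. X i ** Y)"
  by (induction I rule: infinite_finite_induct) (simp_all add: matrix_add_rdistrib matrix_mult_zero_left)

lemma matrix_mult_sum: "Y ** sum X I = (\<Sum>i\<in>I. Y ** X i)"
  by (induction I rule: infinite_finite_induct) (simp_all add: matrix_add_ldistrib matrix_mult_zero_right)

lemma lincomb_eq_sum: "lincomb D c B = (\<Sum>i\<le>D. cscale (c i) (B i))"
  by (simp add: lincomb_def cscale_def Finite_Cartesian_Product.vec_eq_iff)

text \<open>
  \<open>A\<close> are the adjacency matrices of a P-polynomial scheme with tridiagonal matrix \<open>L\<close> of
  intersection numbers \<open>L\<^sub>i\<^sub>j = p\<^sup>i\<^sub>1\<^sub>j\<close>, \<open>n\<close> is the number of points.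
\<close>

locale self_dual_P_polynomial =
  fixes D :: nat and A E :: "nat \<Rightarrow> complex^'x::finite^'x" and L P :: "nat \<Rightarrow> nat \<Rightarrow> complex" and n :: complex
  assumes n_nonzero: "n \<noteq> 0"
    and A_zero: "A 0 = Finite_Cartesian_Product.mat 1"
    and A_sym: "i \<le> D \<Longrightarrow> Finite_Cartesian_Product.transpose (A i) = A i"
    and A_one_mult: "j \<le> D \<Longrightarrow> A 1 ** A j = lincomb D (\<lambda>i. L i j) A"
    and L_sub: "j < D \<Longrightarrow> L (Suc j) j \<noteq> 0"
    and L_zero: "i > Suc j \<Longrightarrow> L i j = 0"
    and D_pos: "0 < D"
    and idempotents: "bij_betw E {..D} (primitive_idempotents (range (\<lambda>c. lincomb D c A)))"
    and A_eq: "j \<le> D \<Longrightarrow> A j = lincomb D (\<lambda>i. P i j) E"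
    and E_eq: "j \<le> D \<Longrightarrow> E j = lincomb D (\<lambda>i. P i j / n) A"
begin

section \<open>The Bose-Mesner algebra and its primitive idempotents\<close>

abbreviation "BM \<equiv> range (\<lambda>c. lincomb D c A)"

lemma BM_cscale:
  assumes "X \<in> BM" shows "cscale c X \<in> BM"
proof -
  obtain c' where "X = lincomb D c' A" using assms by blast
  then have "cscale c X = lincomb D (\<lambda>i. c * c' i) A"
    by (simp add: lincomb_eq_sum cscale_sum cscale_cscale)
  then show ?thesis by blast
qed

lemma BM_add:
  assumes "X \<in> BM" "Y \<in> BM" shows "X + Y \<in> BM"
proof -
  obtain c c' where "X = lincomb D c A" "Y = lincomb D c' A" using assms by blast
  then have "X + Y = lincomb D (\<lambda>i. c i + c' i) A"
    by (simp add: lincomb_def Finite_Cartesian_Product.vec_eq_iff algebra_simps sum.distrib)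
  then show ?thesis by blast
qed

lemma BM_zero: "0 \<in> BM"
proof -
  have "0 = lincomb D (\<lambda>_. 0) A" by (simp add: lincomb_eq_sum)
  then show ?thesis by blast
qed

lemma BM_sum: "(\<And>i. i \<in> I \<Longrightarrow> X i \<in> BM) \<Longrightarrow> sum X I \<in> BM"
  by (induction I rule: infinite_finite_induct) (auto intro: BM_add BM_zero)

lemma BM_diff: "X \<in> BM \<Longrightarrow> Y \<in> BM \<Longrightarrow> X - Y \<in> BM"
proof -
  assume "X \<in> BM" "Y \<in> BM"
  then have "X + cscale (-1) Y \<in> BM" by (intro BM_add BM_cscale)
  also have "X + cscale (-1) Y = X - Y"
    by (simp add: cscale_def Finite_Cartesian_Product.vec_eq_iff)
  finally show ?thesis .
qed

lemma A_one_mult_BM: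
  assumes "X \<in> BM" shows "A 1 ** X \<in> BM"
proof -
  obtain c where X: "X = lincomb D c A" using assms by blast
  have "A 1 ** X = (\<Sum>j\<le>D. cscale (c j) (A 1 ** A j))"
    unfolding X lincomb_eq_sum[of D c] by (simp add: matrix_mult_sum cscale_mult_right)
  also have "\<dots> \<in> BM"
    by (intro BM_sum BM_cscale) (use A_one_mult in auto)
  finally show ?thesis .
qed

text \<open>The product \<open>A 1 ** A k\<close> involves no matrix beyond
  \<open>A (Suc k)\<close>, which occurs with nonzero coefficient. Solving for it reduces
  multiplication by \<open>A (Suc k)\<close> to earlier indices and to \<open>A 1\<close>.\<close>

lemma A_mult_BM:
  assumes "j \<le> D" "X \<in> BM" shows "A j ** X \<in> BM"
  using assms
proof (induction j arbitrary: X rule: less_induct)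
  case (less j)
  show ?case
  proof (cases j)
    case 0
    then show ?thesis using less.prems by (simp add: A_zero)
  next
    case (Suc k)
    then have k: "k < D" "k \<le> D" using less.prems by auto
    have "A 1 ** A k = (\<Sum>i\<in>{..Suc k}. cscale (L i k) (A i))"
      unfolding A_one_mult[OF k(2)] lincomb_eq_sum
      by (rule sum.mono_neutral_right) (use k L_zero in auto)
    then have *: "A 1 ** (A k ** X) = (\<Sum>i\<le>k. cscale (L i k) (A i ** X)) + cscale (L j k) (A j ** X)"
      by (simp add: matrix_mul_assoc matrix_add_rdistrib sum_matrix_mult cscale_mult_left Suc)
    have "cscale (1 / L j k) (A 1 ** (A k ** X) - (\<Sum>i\<le>k. cscale (L i k) (A i ** X))) \<in> BM"
      using less k by (intro BM_cscale BM_diff A_one_mult_BM BM_sum) (auto simp: Suc)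
    moreover have "cscale (1 / L j k) (A 1 ** (A k ** X) - (\<Sum>i\<le>k. cscale (L i k) (A i ** X))) = A j ** X"
      unfolding * using L_sub[OF k(1)] by (simp add: cscale_cscale Suc)
    ultimately show ?thesis by (simp only:)
  qed
qed

lemma BM_mult:
  assumes "X \<in> BM" "Y \<in> BM" shows "X ** Y \<in> BM"
proof -
  obtain c where X: "X = lincomb D c A" using assms by blast
  have "X ** Y = (\<Sum>j\<le>D. cscale (c j) (A j ** Y))"
    unfolding X lincomb_eq_sum[of D c] by (simp add: sum_matrix_mult cscale_mult_left)
  also have "\<dots> \<in> BM"
    by (intro BM_sum BM_cscale A_mult_BM) (use assms in auto)
  finally show ?thesis .
qed

lemma BM_symmetric:
  assumes "X \<in> BM" shows "Finite_Cartesian_Product.transpose X = X"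
proof -
  obtain c where X: "X = lincomb D c A" using assms by blast
  have "A i $ x $ y = A i $ y $ x" if "i \<le> D" for i x y
    using A_sym[OF that]
    by (metis Finite_Cartesian_Product.transpose_def vec_lambda_beta)
  then show ?thesis
    by (simp add: X lincomb_def Finite_Cartesian_Product.transpose_def Finite_Cartesian_Product.vec_eq_iff)
qed

text \<open>The product of two elements is again in the algebra, hence symmetric, and transposition
  reverses the factors.\<close>

lemma BM_commute:
  assumes "X \<in> BM" "Y \<in> BM" shows "X ** Y = Y ** X"
  using BM_symmetric[OF BM_mult[OF assms]] BM_symmetric assms by (metis matrix_transpose_mul)

lemma
  assumes "i \<le> D"
  shows E_in_BM: "E i \<in> BM" and E_nonzero: "E i \<noteq> 0" and E_idem: "E i ** E i = E i"
    and E_primitive: "\<And>F G. F \<in> BM \<Longrightarrow> G \<in> BM \<Longrightarrow> F ** F = F \<Longrightarrow> G ** G = G \<Longrightarrow>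
      F ** G = 0 \<Longrightarrow> G ** F = 0 \<Longrightarrow> E i = F + G \<Longrightarrow> F = 0 \<or> G = 0"
proof -
  have "E i \<in> primitive_idempotents BM"
    using idempotents assms by (auto simp: bij_betw_def)
  then show "E i \<in> BM" "E i \<noteq> 0" "E i ** E i = E i"
    "\<And>F G. F \<in> BM \<Longrightarrow> G \<in> BM \<Longrightarrow> F ** F = F \<Longrightarrow> G ** G = G \<Longrightarrow>
      F ** G = 0 \<Longrightarrow> G ** F = 0 \<Longrightarrow> E i = F + G \<Longrightarrow> F = 0 \<or> G = 0"
    unfolding primitive_idempotents_def by blast+
qed

text \<open>The splitting of \<open>E i\<close> into \<open>E i ** F\<close> and
  \<open>E i - E i ** F\<close> is an orthogonal one, so primitivity forces one summand to
  vanish.\<close>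

lemma E_mult_idempotent:
  assumes "i \<le> D" "F \<in> BM" "F ** F = F" shows "E i ** F = 0 \<or> E i ** F = E i"
proof -
  let ?G = "E i ** F"
  have G: "?G \<in> BM" and EF: "F ** E i = E i ** F"
    using assms E_in_BM BM_mult BM_commute by auto
  have EG: "E i ** ?G = ?G" using E_idem[OF assms(1)] by (simp add: matrix_mul_assoc)
  have GE: "?G ** E i = ?G" using EG BM_commute[OF G E_in_BM[OF assms(1)]] by simp
  have GG: "?G ** ?G = ?G"
    by (metis EF E_idem assms(1,3) matrix_mul_assoc)
  have "?G = 0 \<or> E i - ?G = 0"
  proof (rule E_primitive[OF assms(1)])
    show "E i - ?G \<in> BM" using G E_in_BM assms(1) by (intro BM_diff)
    show "?G ** (E i - ?G) = 0" "(E i - ?G) ** ?G = 0" "(E i - ?G) ** (E i - ?G) = E i - ?G"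
      by (simp_all add: matrix_diff_ldistrib matrix_diff_rdistrib EG GE GG E_idem[OF assms(1)])
  qed (use G GG in auto)
  then show ?thesis by auto
qed

lemma E_orthogonal:
  assumes "i \<le> D" "j \<le> D" "i \<noteq> j" shows "E i ** E j = 0"
proof -
  have "E i \<noteq> E j" using idempotents assms by (auto simp: bij_betw_def inj_on_def)
  moreover have "E i ** E j = 0 \<or> E i ** E j = E i"
    using assms by (intro E_mult_idempotent E_in_BM E_idem)
  moreover have "E j ** E i = 0 \<or> E j ** E i = E j"
    using assms by (intro E_mult_idempotent E_in_BM E_idem)
  ultimately show ?thesis using BM_commute E_in_BM assms by metis
qed

lemma E_mult_lincomb:
  assumes "k \<le> D" shows "E k ** lincomb D c E = cscale (c k) (E k)"
proof -
  have "E k ** lincomb D c E = (\<Sum>i\<le>D. cscale (c i) (E k ** E i))"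
    by (simp add: lincomb_eq_sum matrix_mult_sum cscale_mult_right)
  also have "\<dots> = (\<Sum>i\<le>D. if i = k then cscale (c k) (E k) else 0)"
    by (rule sum.cong) (use assms in \<open>auto simp: E_orthogonal E_idem\<close>)
  finally show ?thesis using assms by simp
qed

lemma E_mult_A: "k \<le> D \<Longrightarrow> j \<le> D \<Longrightarrow> E k ** A j = cscale (P k j) (E k)"
  by (simp add: A_eq E_mult_lincomb)

lemma E_mult_lincomb_A:
  assumes "k \<le> D" shows "E k ** lincomb D c A = cscale (\<Sum>i\<le>D. c i * P k i) (E k)"
  using assms
  by (simp add: lincomb_eq_sum matrix_mult_sum cscale_mult_right E_mult_A cscale_cscale cscale_sum_left)

lemma P_zero: "i \<le> D \<Longrightarrow> P i 0 = 1"
  using E_mult_A[of i 0] cscale_left_cancel[OF E_nonzero, of i "P i 0" 1] by (simp add: A_zero)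

text \<open>Self-duality enters here: the same \<open>P\<close> also expands \<open>E j\<close> in
  the \<open>A i\<close>, up to the factor \<open>n\<close>. Multiplying that expansion by
  \<open>E k\<close> produces an entry of the square of \<open>P\<close>.\<close>

lemma P_square:
  assumes "k \<le> D" "j \<le> D"
  shows "(\<Sum>i\<le>D. P k i * P i j) = (if k = j then n else 0)"
proof -
  have "E k ** E j = cscale (\<Sum>i\<le>D. P i j / n * P k i) (E k)"
    using assms by (simp add: E_eq[of j] E_mult_lincomb_A)
  also have "(\<Sum>i\<le>D. P i j / n * P k i) = (\<Sum>i\<le>D. P k i * P i j) / n"
    by (simp add: sum_divide_distrib mult.commute)
  finally have "cscale ((\<Sum>i\<le>D. P k i * P i j) / n) (E k) = cscale (if k = j then 1 else 0) (E k)"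
    using assms by (auto simp: E_idem E_orthogonal)
  then show ?thesis
    using cscale_left_cancel[OF E_nonzero[OF assms(1)]] n_nonzero by (auto split: if_splits)
qed

text \<open>Both sides are the eigenvalue of \<open>A 1 ** A j\<close> on \<open>E k\<close>,
  computed factor by factor and through the intersection numbers.\<close>

lemma P_mult_L:
  assumes "k \<le> D" "j \<le> D"
  shows "(\<Sum>i\<le>D. P k i * L i j) = P k 1 * P k j"
proof -
  have "E k ** (A 1 ** A j) = cscale (P k 1 * P k j) (E k)"
    using assms D_pos by (simp add: matrix_mul_assoc E_mult_A cscale_mult_left cscale_cscale)
  moreover have "E k ** (A 1 ** A j) = cscale (\<Sum>i\<le>D. P k i * L i j) (E k)"
    unfolding A_one_mult[OF assms(2)] using assms by (simp add: E_mult_lincomb_A mult.commute)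
  ultimately show ?thesis
    using cscale_left_cancel[OF E_nonzero[OF assms(1)]] by metis
qed

end

section \<open>Intersection numbers of the bilinear forms scheme\<close>

locale bilinear_parameters =
  fixes q M N :: nat
  assumes q_gt_1: "q > 1" and min_gt_2: "min M N > 2"
begin

abbreviation "Q \<equiv> of_nat q :: complex"
abbreviation "D \<equiv> min M N"

definition b :: "nat \<Rightarrow> complex" where
  "b i = (Q ^ M - Q ^ i) * (Q ^ N - Q ^ i) / (Q - 1)"

text \<open>The usual form is q^(i-1) (q^i - 1) / (q - 1); dividing by \<open>Q\<close> keeps
  truncated subtraction out of the exponent.\<close>

definition c :: "nat \<Rightarrow> complex" where
  "c i = Q ^ i * (Q ^ i - 1) / (Q * (Q - 1))"

text \<open>The remainder that makes every row of \<open>L\<close> sum to the valency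
  \<open>b 0\<close>.\<close>

definition a :: "nat \<Rightarrow> complex" where
  "a i = b 0 - b i - c i"

definition L :: "nat \<Rightarrow> nat \<Rightarrow> complex" where
  "L i j = (if j = Suc i then b i else if i = Suc j then c i else if i = j then a i else 0)"

lemma Q_nonzero: "Q \<noteq> 0" and Q_neq_1: "Q - 1 \<noteq> 0"
  using q_gt_1 by auto

lemma Q_power_eq_iff: "Q ^ i = Q ^ j \<longleftrightarrow> i = j"
  using q_gt_1 by (simp flip: of_nat_power)

lemma b_nonzero: "i < D \<Longrightarrow> b i \<noteq> 0"
  using Q_neq_1 by (auto simp: b_def Q_power_eq_iff)

lemma b_D: "b D = 0"
  by (auto simp: b_def min_def)

lemma c_0: "c 0 = 0" and c_1: "c (Suc 0) = 1" and a_0: "a 0 = 0"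
  using Q_nonzero Q_neq_1 by (simp_all add: c_def a_def)

lemma c_nonzero: "i > 0 \<Longrightarrow> c i \<noteq> 0"
  using Q_nonzero Q_neq_1 Q_power_eq_iff[of i 0] by (auto simp: c_def)

end

text \<open>The counts that raise and lower the rank are \<open>b\<close> and \<open>c\<close>. All
  other rank-one matrices preserve the rank, so \<open>a\<close> is the total \<open>b 0\<close>
  minus these two.\<close>

lemma bilinear_intersection_number:
  fixes B :: "'f::{field,finite}^'n^'m"
  assumes "min CARD('m) CARD('n) > 2"
  shows "of_nat (card {Z. rank Z = 1 \<and> rank (B + Z) = j}) =
    bilinear_parameters.L CARD('f) CARD('m) CARD('n) (rank B) j"
proof -
  interpret bilinear_parameters "CARD('f)" "CARD('m)" "CARD('n)"
    using assms card_field_gt_one by unfold_locales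
  let ?r = "rank B"
  have le: "CARD('f) ^ ?r \<le> CARD('f) ^ CARD('m)" "CARD('f) ^ ?r \<le> CARD('f) ^ CARD('n)"
    using rank_le_min[of B] q_gt_1 by (auto intro: power_increasing)
  have ge1: "1 \<le> CARD('f) ^ k" for k using q_gt_1 by simp
  let ?S = "{Z. rank Z = 1 \<and> rank (B + Z) = Suc ?r}"
    and ?P = "{Z. rank Z = 1 \<and> Suc (rank (B + Z)) = ?r}"
    and ?E = "{Z. rank Z = 1 \<and> rank (B + Z) = ?r}"
  have "of_nat ((CARD('f) - 1) * card ?S) = (Q - 1) * of_nat (card ?S)"
    using q_gt_1 by (simp add: of_nat_diff)
  moreover have "of_nat ((CARD('f) - 1) * card ?S) = (Q ^ CARD('m) - Q ^ ?r) * (Q ^ CARD('n) - Q ^ ?r)"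
    unfolding card_rank_one_Suc using le by (simp add: of_nat_diff)
  ultimately have S: "of_nat (card ?S) = b ?r"
    using Q_neq_1 by (simp add: b_def field_simps)
  have "of_nat (CARD('f) * ((CARD('f) - 1) * card ?P)) = Q * (Q - 1) * of_nat (card ?P)"
    using q_gt_1 by (simp add: of_nat_diff)
  moreover have "of_nat (CARD('f) * ((CARD('f) - 1) * card ?P)) = (Q ^ ?r - 1) * Q ^ ?r"
    unfolding card_rank_one_pred using ge1 by (simp add: of_nat_diff)
  ultimately have P: "of_nat (card ?P) = c ?r"
    using Q_neq_1 Q_nonzero by (simp add: c_def divide_simps mult_ac)
  let ?T = "{Z :: 'f^'n^'m. rank Z = 1}"
  have "of_nat ((CARD('f) - 1) * card ?T) = (Q - 1) * of_nat (card ?T)"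
    using q_gt_1 by (simp add: of_nat_diff)
  moreover have "of_nat ((CARD('f) - 1) * card ?T) = (Q ^ CARD('m) - 1) * (Q ^ CARD('n) - 1)"
    unfolding card_rank_one_total using ge1 by (simp add: of_nat_diff)
  ultimately have T: "of_nat (card ?T) = b 0"
    using Q_neq_1 by (simp add: b_def field_simps)
  have "?T = (?S \<union> ?P) \<union> ?E" using rank_one_perturbation_cases[of _ B] by blast
  moreover have "card ((?S \<union> ?P) \<union> ?E) = card (?S \<union> ?P) + card ?E"
    by (rule card_Un_disjoint) auto
  moreover have "card (?S \<union> ?P) = card ?S + card ?P"
    by (rule card_Un_disjoint) auto
  ultimately have "of_nat (card ?T) = of_nat (card ?S) + of_nat (card ?P) + (of_nat (card ?E) :: complex)"
    by simp
  then have E: "of_nat (card ?E) = a ?r"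
    unfolding S P T by (simp add: a_def)
  consider "j = Suc ?r" | "?r = Suc j" | "j = ?r" | "j \<noteq> Suc ?r" "?r \<noteq> Suc j" "j \<noteq> ?r" by blast
  then show ?thesis
  proof cases
    case 1
    then show ?thesis using S by (simp add: L_def)
  next
    case 2
    then have "{Z. rank Z = 1 \<and> rank (B + Z) = j} = ?P" by auto
    then show ?thesis using P 2 by (simp add: L_def)
  next
    case 3
    then show ?thesis using E by (simp add: L_def)
  next
    case 4
    have False if "rank Z = 1" "rank (B + Z) = j" for Z
      using rank_one_perturbation_cases[OF that(1), of B] that(2) 4 by auto
    then have "{Z. rank Z = 1 \<and> rank (B + Z) = j} = {}" by blast
    then show ?thesis using 4 by (simp add: L_def)
  qed
qed

lemma adjacency_bilinear_rel:
  "adjacency (bilinear_rel i) $ x $ y = (if rank (x - y) = i then 1 else 0)"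
  by (simp add: adjacency_def bilinear_rel_def)

lemma rank_diff_commute: "rank (x - y) = rank (y - x :: 'f::{field,finite}^'n^'m)"
  using rank_uminus[of "x - y"] by simp

text \<open>An entry counts intermediate points \<open>z\<close>; the substitution
  \<open>Z = z - x\<close> turns them into rank-one perturbations of \<open>x - y\<close>.\<close>

lemma adjacency_bilinear_rel_mult:
  fixes A :: "nat \<Rightarrow> complex^('f::{field,finite}^'n^'m)^('f^'n^'m)"
  defines "A \<equiv> \<lambda>i. adjacency (bilinear_rel i)"
  assumes "min CARD('m) CARD('n) > 2"
  shows "A 1 ** A j =
    lincomb (min CARD('m) CARD('n)) (\<lambda>i. bilinear_parameters.L CARD('f) CARD('m) CARD('n) i j) A"
proof -
  let ?L = "bilinear_parameters.L CARD('f) CARD('m) CARD('n)" and ?D = "min CARD('m) CARD('n)"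
  have "(A 1 ** A j) $ x $ y = (lincomb ?D (\<lambda>i. ?L i j) A) $ x $ y" for x y
  proof -
    have "(A 1 ** A j) $ x $ y = (\<Sum>z\<in>UNIV. if rank (x - z) = 1 \<and> rank (z - y) = j then 1 else 0)"
      unfolding matrix_matrix_mult_def A_def
      by (simp add: adjacency_bilinear_rel if_distrib cong: if_cong) (auto intro: sum.cong)
    also have "\<dots> = of_nat (card {z. rank (x - z) = 1 \<and> rank (z - y) = j})"
      by (simp add: sum.If_cases)
    also have "card {z. rank (x - z) = 1 \<and> rank (z - y) = j} =
        card {Z. rank Z = 1 \<and> rank ((x - y) + Z) = j}"
      by (rule bij_betw_same_card[of "\<lambda>z. z - x"], rule bij_betwI[where g = "\<lambda>Z. Z + x"])
        (auto simp: rank_diff_commute[of x] algebra_simps)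
    also have "of_nat \<dots> = ?L (rank (x - y)) j"
      by (rule bilinear_intersection_number) fact
    also have "\<dots> = (\<Sum>i\<le>?D. ?L i j * (if rank (x - y) = i then 1 else 0))"
      using rank_le_min[of "x - y"] by (simp add: if_distrib cong: if_cong)
    also have "\<dots> = (lincomb ?D (\<lambda>i. ?L i j) A) $ x $ y"
      by (simp add: lincomb_def A_def adjacency_bilinear_rel)
    finally show ?thesis .
  qed
  then show ?thesis by (simp add: Finite_Cartesian_Product.vec_eq_iff)
qed

lemma bilinear_self_dual_P_polynomial:
  fixes E :: "nat \<Rightarrow> complex^('f::{field,finite}^'n^'m)^('f^'n^'m)"
  assumes "min CARD('m) CARD('n) > 2"
    and E: "self_dual_eigenmatrix (min CARD('m) CARD('n)) bilinear_rel E P"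
  shows "self_dual_P_polynomial (min CARD('m) CARD('n)) (\<lambda>i. adjacency (bilinear_rel i)) E
    (bilinear_parameters.L CARD('f) CARD('m) CARD('n)) (\<lambda>i j. P $$ (i, j))
    (of_nat CARD('f^'n^'m))"
proof -
  interpret bilinear_parameters "CARD('f)" "CARD('m)" "CARD('n)"
    using assms card_field_gt_one by unfold_locales
  show ?thesis
  proof
    show "adjacency (bilinear_rel 0) = (Finite_Cartesian_Product.mat 1 :: complex^('f^'n^'m)^('f^'n^'m))"
      by (simp add: Finite_Cartesian_Product.vec_eq_iff adjacency_bilinear_rel rank_eq_zero_iff
          Finite_Cartesian_Product.mat_def)
    show "Finite_Cartesian_Product.transpose (adjacency (bilinear_rel i)) =
        (adjacency (bilinear_rel i) :: complex^('f^'n^'m)^('f^'n^'m))" for i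
      by (simp add: Finite_Cartesian_Product.vec_eq_iff adjacency_bilinear_rel
          Finite_Cartesian_Product.transpose_def rank_diff_commute)
    show "adjacency (bilinear_rel 1) ** (adjacency (bilinear_rel j) :: complex^('f^'n^'m)^('f^'n^'m)) =
        lincomb D (\<lambda>i. L i j) (\<lambda>i. adjacency (bilinear_rel i))" for j
      by (rule adjacency_bilinear_rel_mult) fact
  qed (use c_nonzero E assms(1)
      in \<open>auto simp: L_def self_dual_eigenmatrix_def idempotent_ordering_def bose_mesner_def
        first_eigenmatrix_def second_eigenmatrix_def\<close>)
qed

section \<open>The eigenvalues\<close>

text \<open>Only numerical consequences of the scheme are kept. That \<open>P i 1\<close> has the
  expected value is not assumed but derived in \<open>P_one\<close>.\<close>

locale bilinear_eigenmatrix = bilinear_parameters +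
  fixes P :: "nat \<Rightarrow> nat \<Rightarrow> complex" and n :: complex
  assumes n_nonzero: "n \<noteq> 0"
    and P_zero: "i \<le> D \<Longrightarrow> P i 0 = 1"
    and P_square: "i \<le> D \<Longrightarrow> j \<le> D \<Longrightarrow> (\<Sum>k\<le>D. P i k * P k j) = (if i = j then n else 0)"
    and P_mult_L: "i \<le> D \<Longrightarrow> j \<le> D \<Longrightarrow> (\<Sum>k\<le>D. P i k * L k j) = P i 1 * P i j"

section \<open>Eigenvectors of the tridiagonal matrix \<open>L\<close> and the valencies\<close>

context bilinear_parameters
begin

text \<open>The boundary terms are harmless: at \<open>i = 0\<close> the truncated index
  \<open>i - 1\<close> is multiplied by \<open>c 0 = 0\<close>, and at \<open>i = D\<close> the
  index beyond the range by \<open>b D = 0\<close>.\<close>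

lemma L_row_sum:
  assumes "i \<le> D"
  shows "(\<Sum>j\<le>D. L i j * w j) = c i * w (i - 1) + a i * w i + b i * w (Suc i)"
proof -
  have "(\<Sum>j\<le>D. L i j * w j) = (\<Sum>j\<le>D. if j = Suc i then b i * w (Suc i) else 0)
      + (\<Sum>j\<le>D. if j = i - 1 then c i * w (i - 1) else 0) + (\<Sum>j\<le>D. if j = i then a i * w i else 0)"
    unfolding sum.distrib[symmetric]
    by (rule sum.cong) (auto simp: L_def c_0)
  moreover have "(\<Sum>j\<le>D. if j = Suc i then b i * w (Suc i) else 0) = b i * w (Suc i)"
    using assms b_D by (cases "i = D") auto
  moreover have "i - 1 \<le> D" using assms by (rule le_trans[OF diff_le_self])
  ultimately show ?thesis using assms by simp
qed

text \<open>The three-term recurrence determines an eigenvector from its entry 0, because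
  \<open>b k\<close> is nonzero for \<open>k < D\<close>.\<close>

lemma right_eigenvector_unique:
  assumes f: "\<And>i. i \<le> D \<Longrightarrow> (\<Sum>j\<le>D. L i j * f j) = \<theta> * f i"
    and g: "\<And>i. i \<le> D \<Longrightarrow> (\<Sum>j\<le>D. L i j * g j) = \<theta> * g i"
    and "i \<le> D"
  shows "f i * g 0 = g i * f 0"
  using assms(3)
proof (induction i rule: less_induct)
  case (less i)
  show ?case
  proof (cases i)
    case (Suc k)
    then have k: "k < D" using less.prems by simp
    have step: "b k * w i = (\<theta> - a k) * w k - c k * w (k - 1)"
      if "(\<Sum>j\<le>D. L k j * w j) = \<theta> * w k" for w
      using that L_row_sum[of k w] k by (simp add: Suc left_diff_distrib eq_diff_eq add_ac)
    have "b k * (f i * g 0) = (\<theta> - a k) * (f k * g 0) - c k * (f (k - 1) * g 0)"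
      using step[of f] f[of k] k by (simp add: left_diff_distrib flip: mult.assoc)
    also have "\<dots> = (\<theta> - a k) * (g k * f 0) - c k * (g (k - 1) * f 0)"
      using less.IH[of k] less.IH[of "k - 1"] less.prems Suc by simp
    also have "\<dots> = b k * (g i * f 0)"
      using step[of g] g[of k] k by (simp add: left_diff_distrib flip: mult.assoc)
    finally have "b k * (f i * g 0) = b k * (g i * f 0)" .
    then show ?thesis using b_nonzero[OF k] by simp
  qed simp
qed

text \<open>The valencies of the scheme; \<open>P_0\<close> identifies them with row 0 of
  \<open>P\<close>. They are also the weights that symmetrise \<open>L\<close>.\<close>

primrec \<kappa> :: "nat \<Rightarrow> complex" where
  "\<kappa> 0 = 1"
| "\<kappa> (Suc i) = \<kappa> i * b i / c (Suc i)"

lemma \<kappa>_nonzero: "i \<le> D \<Longrightarrow> \<kappa> i \<noteq> 0"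
  by (induction i) (auto simp: b_nonzero c_nonzero)

lemma \<kappa>_balance: "\<kappa> i * L i j = \<kappa> j * L j i"
  by (auto simp: L_def c_nonzero)

definition \<theta> :: "nat \<Rightarrow> complex" where
  "\<theta> i = (Q ^ M * Q ^ N / Q ^ i + 1 - Q ^ M - Q ^ N) / (Q - 1)"

lemma \<theta>_0: "\<theta> 0 = b 0"
  by (simp add: \<theta>_def b_def algebra_simps)

lemma c_mult_shift: "c i * (1 / Q ^ (i - 1)) = c i * (Q / Q ^ i)"
  using Q_nonzero by (cases i) (simp_all add: c_0)

lemma \<theta>_eigenvector:
  assumes "i \<le> D" shows "(\<Sum>j\<le>D. L i j * \<theta> j) = \<theta> 1 * \<theta> i"
proof -
  define d e x where "d = Q ^ M" and "e = Q ^ N" and "x = Q ^ i"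
  have x: "x \<noteq> 0" using Q_nonzero by (simp add: x_def)
  have "c i * \<theta> (i - 1) = (d * e * (c i * (1 / Q ^ (i - 1))) + c i * (1 - d - e)) / (Q - 1)"
    by (simp add: \<theta>_def d_def e_def algebra_simps diff_divide_distrib add_divide_distrib)
  then have "(\<Sum>j\<le>D. L i j * \<theta> j) = (d * e * (c i * (1 / Q ^ (i - 1))) + c i * (1 - d - e)) / (Q - 1)
      + a i * \<theta> i + b i * \<theta> (Suc i)"
    by (simp only: L_row_sum[OF assms])
  also have "\<dots> = \<theta> 1 * \<theta> i"
    unfolding c_mult_shift unfolding a_def b_def c_def \<theta>_def d_def[symmetric] e_def[symmetric] x_def[symmetric] power_Suc power_0 power_one_right
    using x Q_nonzero Q_neq_1 by (simp add: divide_simps) (simp add: algebra_simps)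
  finally show ?thesis .
qed

text \<open>\<open>g\<close> is the quadratic polynomial in \<open>q\<^sup>-\<^sup>i\<close> that solves \<open>(L - b\<^sub>0) g = \<theta>\<^sup>2 - b\<^sub>0\<close>.\<close>

lemma \<theta>_square_coboundary:
  obtains g where "\<And>i. i \<le> D \<Longrightarrow> (\<Sum>j\<le>D. L i j * g j) - b 0 * g i = (\<theta> i)\<^sup>2 - b 0"
proof
  define d e where "d = Q ^ M" and "e = Q ^ N"
  \<comment> \<open>Comparing the coefficients of \<open>(1 / Q ^ i)\<^sup>2\<close> determines
    \<open>X\<close>; those of \<open>1 / Q ^ i\<close> then determine \<open>Y\<close>.\<close>
  define X where "X = - (d * e * Q\<^sup>2) / ((Q - 1) * (Q - 1) * (Q + 1))"
  define Y where "Y = Q * (d + e + Q - 2) / (Q - 1)\<^sup>2"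
  define g where "g i = X * (1 / Q ^ i)\<^sup>2 + Y * (1 / Q ^ i)" for i
  have Q1: "Q + 1 \<noteq> 0" by (metis of_nat_Suc of_nat_neq_0 add.commute)
  fix i assume i: "i \<le> D"
  define x where "x = Q ^ i"
  have x: "x \<noteq> 0" using Q_nonzero by (simp add: x_def)
  have cg: "c i * g (i - 1) = c i * (X * (Q / x)\<^sup>2 + Y * (Q / x))"
  proof (cases i)
    case (Suc k)
    then show ?thesis using Q_nonzero by (simp add: g_def x_def)
  qed (simp add: c_0)
  have "(\<Sum>j\<le>D. L i j * g j) - b 0 * g i =
      c i * (X * (Q / x)\<^sup>2 + Y * (Q / x)) + a i * g i + b i * g (Suc i) - b 0 * g i"
    by (simp only: L_row_sum[OF i] cg)
  also have "\<dots> = c i * (X * ((Q / x)\<^sup>2 - (1 / x)\<^sup>2) + Y * (Q / x - 1 / x))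
      + b i * (X * ((1 / (Q * x))\<^sup>2 - (1 / x)\<^sup>2) + Y * (1 / (Q * x) - 1 / x))"
    by (simp add: a_def g_def x_def algebra_simps)
  also have "\<dots> = (\<theta> i)\<^sup>2 - b 0"
    unfolding b_def c_def \<theta>_def X_def Y_def d_def[symmetric] e_def[symmetric] x_def[symmetric] power_0
    using x Q_nonzero Q_neq_1 Q1
    by (simp add: divide_simps power2_eq_square) (simp add: algebra_simps)
  finally show "(\<Sum>j\<le>D. L i j * g j) - b 0 * g i = (\<theta> i)\<^sup>2 - b 0" .
qed

lemma coprime_power_diff_one: "k > 0 \<Longrightarrow> coprime (x ^ k - 1) (x :: int)"
  using coprime_diff_one_left[of "x ^ k"] by (simp del: coprime_diff_one_left)

text \<open>\<open>\<kappa>\<^sub>m\<close> is \<open>q\<^bsup>m(m-1)/2\<^esup>\<close> times a \<open>q\<close>-adic unit.\<close>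

lemma \<kappa>_divisibility:
  assumes "1 \<le> m" "m \<le> D"
  shows "\<exists>s r :: int. coprime s (int q) \<and> \<kappa> m * of_int s = of_int r \<and> (m \<ge> 2 \<longrightarrow> int q dvd r)"
  using assms
proof (induction m rule: dec_induct)
  case base
  let ?r = "(int q ^ M - 1) * (int q ^ N - 1)"
  have "\<kappa> 1 * of_int (int q - 1) = of_int ?r"
    using Q_neq_1 by (simp add: c_1 b_def)
  then have "coprime (int q - 1) (int q) \<and> \<kappa> 1 * of_int (int q - 1) = of_int ?r \<and> (1 \<ge> (2 :: nat) \<longrightarrow> int q dvd ?r)"
    by (intro conjI coprime_diff_one_left) auto
  then show ?case by (intro exI)
next
  case (step m)
  then obtain s r where sr: "coprime s (int q)" "\<kappa> m * of_int s = of_int r" by auto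
  have m: "m < M" "m < N" "0 < m" using step by auto
  \<comment> \<open>In \<open>b m / c (Suc m)\<close> the powers \<open>Q ^ m\<close> cancel. The
    remaining numerator factor \<open>Q ^ N - Q ^ m\<close> is divisible by \<open>q\<close> as
    \<open>m\<close> is positive, and the denominator is prime to \<open>q\<close>.\<close>
  let ?s = "s * (int q ^ Suc m - 1)" and ?r = "r * (int q ^ (M - m) - 1) * (int q ^ N - int q ^ m)"
  have "coprime ?s (int q)" using sr coprime_power_diff_one[of "Suc m" "int q"] by simp
  moreover have "\<kappa> (Suc m) * of_int ?s = of_int ?r"
  proof -
    have c: "c (Suc m) = Q ^ m * (Q ^ Suc m - 1) / (Q - 1)"
      using Q_nonzero Q_neq_1 by (simp add: c_def)
    have nz: "Q ^ Suc m - 1 \<noteq> 0" using Q_power_eq_iff[of "Suc m" 0] by simp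
    have "Q ^ M = Q ^ m * Q ^ (M - m)" using m by (simp flip: power_add)
    then have b: "b m = Q ^ m * (Q ^ (M - m) - 1) * (Q ^ N - Q ^ m) / (Q - 1)"
      by (simp add: b_def algebra_simps)
    have "b m / c (Suc m) * (Q ^ Suc m - 1) = (Q ^ (M - m) - 1) * (Q ^ N - Q ^ m)"
      unfolding b c using Q_nonzero Q_neq_1 nz by (simp add: divide_simps del: power_Suc)
    then have "\<kappa> m * of_int s * (b m / c (Suc m) * (Q ^ Suc m - 1)) =
        of_int r * ((Q ^ (M - m) - 1) * (Q ^ N - Q ^ m))"
      by (simp only: sr)
    then show ?thesis by (simp add: mult_ac)
  qed
  moreover have "int q dvd ?r"
    using m by (intro dvd_mult dvd_diff) auto
  ultimately show ?case by blast
qed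

text \<open>Size excludes \<open>m = 0\<close>. For \<open>m \<ge> 2\<close>, \<open>q\<close>
  divides the numerator of \<open>\<kappa> m\<close>, whereas the numerator of
  \<open>\<kappa> 1\<close> is prime to \<open>q\<close>.\<close>

lemma \<kappa>_eq_\<kappa>_1_imp:
  assumes "m \<le> D" "\<kappa> m = \<kappa> 1" shows "m = 1"
proof (rule ccontr)
  assume "m \<noteq> 1"
  let ?v = "(int q ^ M - 1) * (int q ^ N - 1)"
  have \<kappa>1: "\<kappa> 1 * of_int (int q - 1) = of_int ?v"
    using Q_neq_1 by (simp add: c_1 b_def)
  consider "m = 0" | "m \<ge> 2" using \<open>m \<noteq> 1\<close> by linarith
  then show False
  proof cases
    case 1
    then have "(of_int (int q - 1) :: complex) = of_int ?v" using \<kappa>1 assms by simp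
    then have eq: "int q - 1 = ?v" by (simp only: of_int_eq_iff)
    have "int q ^ M > int q ^ 1" "int q ^ N > int q ^ 1"
      using q_gt_1 min_gt_2 by (intro power_strict_increasing; simp)+
    then have MN: "int q < int q ^ M" "int q < int q ^ N" by simp_all
    then have "(int q ^ M - 1) * 1 \<le> ?v" using q_gt_1 by (intro mult_left_mono) linarith+
    moreover have "int q - 1 < (int q ^ M - 1) * 1" using MN by simp
    ultimately show False using eq by linarith
  next
    case 2
    then obtain s r where sr: "coprime s (int q)" "\<kappa> m * of_int s = of_int r" "int q dvd r"
      using \<kappa>_divisibility[of m] assms by auto
    have "of_int (r * (int q - 1)) = of_int s * (\<kappa> 1 * of_int (int q - 1))"
      by (simp only: of_int_mult sr(2)[symmetric] assms(2) mult_ac)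
    also have "\<dots> = of_int (s * ?v)"
      by (simp only: \<kappa>1 of_int_mult)
    finally have "r * (int q - 1) = s * ?v" by (simp only: of_int_eq_iff)
    then have "int q dvd s * ?v" using sr(3) by (metis dvd_mult2)
    moreover have "coprime (s * ?v) (int q)"
      using sr(1) min_gt_2 by (simp add: coprime_power_diff_one)
    ultimately have "is_unit (int q)" by (metis coprime_common_divisor dvd_refl)
    then show False using q_gt_1 by simp
  qed
qed

end

section \<open>Identification of column 1 of the eigenmatrix\<close>

context bilinear_eigenmatrix
begin

text \<open>In matrix form, \<open>P L = \<theta> P\<close> gives \<open>P L P = n \<theta>\<close>;
  multiplying by \<open>P\<close> from the left and cancelling \<open>n\<close> gives
  \<open>L P = P \<theta>\<close>, where \<open>\<theta>\<close> stands for the diagonal of the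
  \<open>P i 1\<close>.\<close>

lemma L_mult_P:
  assumes "i \<le> D" "m \<le> D"
  shows "(\<Sum>j\<le>D. L i j * P j m) = P m 1 * P i m"
proof -
  have inner: "(\<Sum>k\<le>D. P l k * (\<Sum>j\<le>D. L k j * P j m)) = P l 1 * (if l = m then n else 0)" if "l \<le> D" for l
  proof -
    have "(\<Sum>k\<le>D. P l k * (\<Sum>j\<le>D. L k j * P j m)) = (\<Sum>j\<le>D. (\<Sum>k\<le>D. P l k * L k j) * P j m)"
      by (simp only: sum_distrib_left sum_distrib_right mult.assoc) (rule sum.swap)
    also have "\<dots> = (\<Sum>j\<le>D. P l 1 * (P l j * P j m))"
      by (intro sum.cong refl) (use that in \<open>simp add: P_mult_L mult.assoc\<close>)
    also have "\<dots> = P l 1 * (if l = m then n else 0)"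
      using P_square[OF that assms(2)] by (simp flip: sum_distrib_left)
    finally show ?thesis .
  qed
  have "(\<Sum>l\<le>D. P i l * (\<Sum>k\<le>D. P l k * (\<Sum>j\<le>D. L k j * P j m)))
      = (\<Sum>k\<le>D. (\<Sum>l\<le>D. P i l * P l k) * (\<Sum>j\<le>D. L k j * P j m))"
    by (simp only: sum_distrib_left[of "P _ _" "\<lambda>k. P _ k * _ k"] sum_distrib_right mult.assoc) (rule sum.swap)
  also have "\<dots> = (\<Sum>k\<le>D. if k = i then n * (\<Sum>j\<le>D. L i j * P j m) else 0)"
    by (intro sum.cong refl) (use assms in \<open>auto simp: P_square\<close>)
  finally have "n * (\<Sum>j\<le>D. L i j * P j m) = (\<Sum>l\<le>D. P i l * (\<Sum>k\<le>D. P l k * (\<Sum>j\<le>D. L k j * P j m)))"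
    using assms by simp
  also have "\<dots> = (\<Sum>l\<le>D. if l = m then n * (P m 1 * P i m) else 0)"
    by (intro sum.cong refl) (use inner in auto)
  finally show ?thesis using assms n_nonzero by simp
qed

text \<open>Row \<open>m\<close> of \<open>P\<close> is a left eigenvector of \<open>L\<close>;
  dividing it by \<open>\<kappa>\<close> makes it a right eigenvector by
  \<open>\<kappa>_balance\<close>, hence proportional to column \<open>m\<close>.\<close>

lemma \<kappa>_mult_P_eq_P_0_mult:
  assumes "k \<le> D" "m \<le> D"
  shows "\<kappa> k * P k m = P 0 m * P m k"
proof -
  have "(\<Sum>j\<le>D. L i j * (P m j / \<kappa> j)) = P m 1 * (P m i / \<kappa> i)" if "i \<le> D" for i
  proof -
    have "L i j * (P m j / \<kappa> j) = P m j * L j i / \<kappa> i" if "j \<le> D" for j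
    proof -
      have "L i j / \<kappa> j = L j i / \<kappa> i"
        using \<kappa>_balance[of i j] \<kappa>_nonzero[OF that] \<kappa>_nonzero[OF \<open>i \<le> D\<close>]
        by (simp add: frac_eq_eq mult.commute)
      then have "P m j * (L i j / \<kappa> j) = P m j * (L j i / \<kappa> i)" by (simp only:)
      then show ?thesis by (simp add: mult.commute)
    qed
    then have "(\<Sum>j\<le>D. L i j * (P m j / \<kappa> j)) = (\<Sum>j\<le>D. P m j * L j i / \<kappa> i)"
      by (intro sum.cong refl) simp
    then show ?thesis
      using P_mult_L[OF assms(2) that] by (simp flip: sum_divide_distrib)
  qed
  then have "P k m * (P m 0 / \<kappa> 0) = P m k / \<kappa> k * P 0 m"
    using L_mult_P[OF _ assms(2)] assms by (intro right_eigenvector_unique[where \<theta> = "P m 1"]) auto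
  then show ?thesis
    using \<kappa>_nonzero[OF assms(1)] assms by (simp add: P_zero field_simps)
qed

lemma P_0: "k \<le> D \<Longrightarrow> P 0 k = \<kappa> k"
  using \<kappa>_mult_P_eq_P_0_mult[of k 0] by (simp add: P_zero)

lemma \<kappa>_mult_P: "k \<le> D \<Longrightarrow> m \<le> D \<Longrightarrow> \<kappa> k * P k m = \<kappa> m * P m k"
  using \<kappa>_mult_P_eq_P_0_mult[of k m] P_0[of m] by simp

lemma \<kappa>_functional: "(\<Sum>i\<le>D. \<kappa> i * (\<Sum>j\<le>D. L i j * w j)) = b 0 * (\<Sum>i\<le>D. \<kappa> i * w i)"
proof -
  have "(\<Sum>i\<le>D. \<kappa> i * (\<Sum>j\<le>D. L i j * w j)) = (\<Sum>j\<le>D. (\<Sum>i\<le>D. P 0 i * L i j) * w j)"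
    by (simp add: P_0 sum_distrib_left sum_distrib_right mult.assoc) (rule sum.swap)
  also have "\<dots> = (\<Sum>j\<le>D. P 0 1 * P 0 j * w j)"
    by (intro sum.cong refl) (simp only: P_mult_L atMost_iff le0)
  also have "\<dots> = (\<Sum>j\<le>D. b 0 * (\<kappa> j * w j))"
    using min_gt_2 by (intro sum.cong refl) (simp add: P_0 c_1)
  finally show ?thesis by (simp add: sum_distrib_left)
qed

lemma sum_\<kappa>: "(\<Sum>i\<le>D. \<kappa> i) = n"
  using P_square[of 0 0] by (simp add: P_0 P_zero)

text \<open>The left eigenvector \<open>\<kappa>\<close> for \<open>b 0\<close> annihilates the
  image of \<open>L - b 0\<close>, and that image contains
  \<open>\<theta>\<^sup>2 - b 0\<close>.\<close>

lemma sum_\<kappa>_\<theta>_square: "(\<Sum>i\<le>D. \<kappa> i * (\<theta> i)\<^sup>2) = n * b 0"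
proof -
  obtain g where g: "\<And>i. i \<le> D \<Longrightarrow> (\<Sum>j\<le>D. L i j * g j) - b 0 * g i = (\<theta> i)\<^sup>2 - b 0"
    by (rule \<theta>_square_coboundary) (rule that)
  have "(\<Sum>i\<le>D. \<kappa> i * ((\<theta> i)\<^sup>2 - b 0)) = (\<Sum>i\<le>D. \<kappa> i * ((\<Sum>j\<le>D. L i j * g j) - b 0 * g i))"
    by (intro sum.cong refl) (simp add: g)
  also have "\<dots> = (\<Sum>i\<le>D. \<kappa> i * (\<Sum>j\<le>D. L i j * g j)) - b 0 * (\<Sum>i\<le>D. \<kappa> i * g i)"
    by (simp only: right_diff_distrib sum_subtractf sum_distrib_left mult.left_commute)
  also have "\<dots> = 0" by (simp add: \<kappa>_functional)
  finally show ?thesis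
    by (simp add: right_diff_distrib sum_subtractf sum_\<kappa> flip: sum_distrib_right)
qed

text \<open>The vector \<open>y\<close>, the image of \<open>\<theta>\<close> under
  \<open>P\<close>, satisfies \<open>(P i 1 - \<theta> 1) * y i = 0\<close>. It is nonzero because
  applying \<open>P\<close> once more gives \<open>n\<close> times \<open>\<theta>\<close>.\<close>

lemma \<theta>_1_occurs:
  obtains m where "m \<le> D" "P m 1 = \<theta> 1"
proof -
  define y where "y i = (\<Sum>k\<le>D. P i k * \<theta> k)" for i
  have "P i 1 * y i = \<theta> 1 * y i" if "i \<le> D" for i
  proof -
    have "P i 1 * y i = (\<Sum>j\<le>D. (\<Sum>k\<le>D. P i k * L k j) * \<theta> j)"
      using that by (simp add: y_def P_mult_L sum_distrib_left mult.assoc)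
    also have "\<dots> = (\<Sum>k\<le>D. P i k * (\<Sum>j\<le>D. L k j * \<theta> j))"
      by (simp only: sum_distrib_left sum_distrib_right mult.assoc) (rule sum.swap)
    also have "\<dots> = (\<Sum>k\<le>D. P i k * (\<theta> 1 * \<theta> k))"
      by (intro sum.cong refl) (simp add: \<theta>_eigenvector)
    also have "\<dots> = \<theta> 1 * y i"
      by (simp add: y_def sum_distrib_left mult_ac)
    finally show ?thesis .
  qed
  moreover have "\<exists>i\<le>D. y i \<noteq> 0"
  proof (rule ccontr)
    assume "\<not> (\<exists>i\<le>D. y i \<noteq> 0)"
    then have "0 = (\<Sum>i\<le>D. P 0 i * y i)" by simp
    also have "\<dots> = (\<Sum>k\<le>D. (\<Sum>i\<le>D. P 0 i * P i k) * \<theta> k)"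
      unfolding y_def by (simp only: sum_distrib_left sum_distrib_right mult.assoc) (rule sum.swap)
    also have "\<dots> = (\<Sum>k\<le>D. if k = 0 then n * \<theta> 0 else 0)"
      by (intro sum.cong refl) (auto simp: P_square)
    also have "\<dots> = n * b 0" by (simp add: \<theta>_0)
    finally show False using n_nonzero b_nonzero[of 0] min_gt_2 by simp
  qed
  ultimately show ?thesis using that by (metis mult_right_cancel)
qed

text \<open>The \<open>\<kappa>\<close>-weighted square sum of column \<open>m\<close> is
  \<open>n * \<kappa> m\<close>. The column is \<open>\<theta>\<close> times
  \<open>\<kappa> m / b 0\<close>, so \<open>sum_\<kappa>_\<theta>_square\<close> forces
  \<open>\<kappa> m = b 0 = \<kappa> 1\<close>.\<close>

lemma P_one:
  assumes "j \<le> D" shows "P j 1 = \<theta> j"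
proof -
  have b0: "b 0 \<noteq> 0" using b_nonzero[of 0] min_gt_2 by simp
  obtain m where m: "m \<le> D" "P m 1 = \<theta> 1" using \<theta>_1_occurs .
  have col: "P j m * b 0 = \<theta> j * \<kappa> m" if "j \<le> D" for j
    using right_eigenvector_unique[of "\<lambda>j. P j m" "\<theta> 1" \<theta> j] L_mult_P[OF _ m(1)] m \<theta>_eigenvector that
    by (simp add: \<theta>_0 P_0)
  have "(\<Sum>j\<le>D. \<kappa> m * P m j * P j m) = \<kappa> m * n"
    using P_square[of m m] m by (simp add: mult.assoc flip: sum_distrib_left)
  then have "n * \<kappa> m * (b 0)\<^sup>2 = (\<Sum>j\<le>D. \<kappa> m * P m j * P j m) * (b 0)\<^sup>2"
    by simp
  also have "\<dots> = (\<Sum>j\<le>D. \<kappa> j * (P j m * b 0)\<^sup>2)"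
    unfolding sum_distrib_right
    by (intro sum.cong refl) (use \<kappa>_mult_P[OF _ m(1)] in \<open>simp add: power2_eq_square mult_ac\<close>)
  also have "\<dots> = (\<Sum>j\<le>D. (\<kappa> m)\<^sup>2 * (\<kappa> j * (\<theta> j)\<^sup>2))"
    by (intro sum.cong refl) (simp add: col power_mult_distrib mult_ac)
  also have "\<dots> = (\<kappa> m)\<^sup>2 * (n * b 0)"
    by (simp only: sum_\<kappa>_\<theta>_square flip: sum_distrib_left)
  finally have "(n * \<kappa> m * b 0) * b 0 = (n * \<kappa> m * b 0) * \<kappa> m"
    by (simp add: power2_eq_square mult_ac)
  then have "\<kappa> m = \<kappa> 1" using b0 n_nonzero \<kappa>_nonzero[OF m(1)] by (simp add: c_1)
  then have "m = 1" using \<kappa>_eq_\<kappa>_1_imp m by blast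
  then show ?thesis using col[OF assms] b0 by (simp add: c_1)
qed

end

section \<open>Diagonal matrices whose product with \<open>P\<close> has order three\<close>

lemma mult_mat_swap:
  fixes A :: "complex mat"
  assumes "A * B = C * D'" "A \<in> carrier_mat m m" "B \<in> carrier_mat m m" "C \<in> carrier_mat m m"
    "D' \<in> carrier_mat m m" "Z \<in> carrier_mat m m"
  shows "A * (B * Z) = C * (D' * Z)"
  using assoc_mult_mat[of A m m B m Z m] assoc_mult_mat[of C m m D' m Z m] assms by simp

lemma index_mult_mat_sum:
  assumes "A \<in> carrier_mat m m" "B \<in> carrier_mat m m" "i < m" "j < m"
  shows "(A * B) $$ (i, j) = (\<Sum>k<m. A $$ (i, k) * (B $$ (k, j) :: complex))"
  using assms by (auto simp: scalar_prod_def atLeast0LessThan intro: sum.cong)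

text \<open>An entry of a product sums over intermediate indices; at the maximal offset
  \<open>p + r\<close> only the index \<open>i + p\<close> survives both bands.\<close>

lemma index_mult_mat_upper_band:
  assumes A: "A \<in> carrier_mat m m" and B: "B \<in> carrier_mat m m" and "j < m"
    and bandA: "\<And>i j. i < m \<Longrightarrow> j < m \<Longrightarrow> i + p < j \<Longrightarrow> A $$ (i, j) = 0"
    and bandB: "\<And>i j. i < m \<Longrightarrow> j < m \<Longrightarrow> i + r < j \<Longrightarrow> B $$ (i, j) = (0 :: complex)"
  shows "i + (p + r) < j \<Longrightarrow> (A * B) $$ (i, j) = 0"
    and "j = i + (p + r) \<Longrightarrow> (A * B) $$ (i, j) = A $$ (i, i + p) * B $$ (i + p, j)"
proof -
  have *: "(A * B) $$ (i, j) = (\<Sum>k<m. if k = i + p \<and> j = i + (p + r) then A $$ (i, i + p) * B $$ (i + p, j) else 0)"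
    if "i + (p + r) \<le> j"
    unfolding index_mult_mat_sum[OF A B, of i j, OF order_le_less_trans[OF trans_le_add1[OF order_refl] order_le_less_trans[OF that \<open>j < m\<close>]] \<open>j < m\<close>]
  proof (rule sum.cong)
    fix k assume "k \<in> {..<m}"
    then have k: "k < m" by simp
    have i: "i < m" using that \<open>j < m\<close> by simp
    show "A $$ (i, k) * B $$ (k, j) = (if k = i + p \<and> j = i + (p + r) then A $$ (i, i + p) * B $$ (i + p, j) else 0)"
    proof (cases "i + p < k")
      case True
      then show ?thesis using bandA[OF i k] by simp
    next
      case False
      show ?thesis
      proof (cases "k + r < j")
        case True
        then show ?thesis using bandB[OF k \<open>j < m\<close>] by auto
      next
        case ge: False
        have "k = i + p" "j = i + (p + r)" using False ge that by linarith+
        then show ?thesis by simp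
      qed
    qed
  qed simp
  show "(A * B) $$ (i, j) = 0" if "i + (p + r) < j"
    using * that by simp
  show "(A * B) $$ (i, j) = A $$ (i, i + p) * B $$ (i + p, j)" if "j = i + (p + r)"
    using * that \<open>j < m\<close> by simp
qed

text \<open>Offset 3 is maximal for three tridiagonal factors, so a single path remains. The entry
  below the diagonal follows by transposition.\<close>

lemma index_triple_mult_tridiagonal:
  fixes A B C :: "complex mat"
  assumes carrier: "A \<in> carrier_mat m m" "B \<in> carrier_mat m m" "C \<in> carrier_mat m m" and "3 < m"
    and tri: "\<And>X i j. X \<in> {A, B, C} \<Longrightarrow> i < m \<Longrightarrow> j < m \<Longrightarrow> i + 1 < j \<or> j + 1 < i \<Longrightarrow> X $$ (i, j) = 0"
  shows "(A * (B * C)) $$ (0, 3) = A $$ (0, 1) * B $$ (1, 2) * C $$ (2, 3)"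
    and "(A * (B * C)) $$ (3, 0) = A $$ (3, 2) * B $$ (2, 1) * C $$ (1, 0)"
proof -
  have band: "(X * (Y * Z)) $$ (0, 3) = X $$ (0, 1) * Y $$ (1, 2) * Z $$ (2, 3)"
    if XYZ: "X \<in> carrier_mat m m" "Y \<in> carrier_mat m m" "Z \<in> carrier_mat m m"
      and tri': "\<And>W i j. W \<in> {X, Y, Z} \<Longrightarrow> i < m \<Longrightarrow> j < m \<Longrightarrow> i + 1 < j \<Longrightarrow> W $$ (i, j) = 0"
    for X Y Z :: "complex mat"
  proof -
    have "(Y * Z) $$ (i, j) = 0" if "i + 2 < j" "j < m" for i j
      using index_mult_mat_upper_band(1)[OF XYZ(2,3) that(2), of 1 1 i] tri' that by auto
    then have "(X * (Y * Z)) $$ (0, 3) = X $$ (0, 1) * (Y * Z) $$ (1, 3)"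
      using index_mult_mat_upper_band(2)[OF XYZ(1) mult_carrier_mat[OF XYZ(2,3)], of 3 1 2 0] tri' \<open>3 < m\<close>
      by auto
    moreover have "(Y * Z) $$ (1, 3) = Y $$ (1, 2) * Z $$ (2, 3)"
      using index_mult_mat_upper_band(2)[OF XYZ(2,3), of 3 1 1 1] tri' \<open>3 < m\<close> by (auto simp: numeral_2_eq_2)
    ultimately show ?thesis by simp
  qed
  show "(A * (B * C)) $$ (0, 3) = A $$ (0, 1) * B $$ (1, 2) * C $$ (2, 3)"
    using carrier tri by (intro band) blast+
  have T: "transpose_mat (A * (B * C)) = transpose_mat C * (transpose_mat B * transpose_mat A)"
    using carrier by (simp add: transpose_mult[of _ m m _ m] assoc_mult_mat[of _ m m _ m _ m])
  have "(transpose_mat C * (transpose_mat B * transpose_mat A)) $$ (0, 3) =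
      transpose_mat C $$ (0, 1) * transpose_mat B $$ (1, 2) * transpose_mat A $$ (2, 3)"
    using carrier tri by (intro band) auto
  then have "transpose_mat (A * (B * C)) $$ (0, 3) =
      transpose_mat C $$ (0, 1) * transpose_mat B $$ (1, 2) * transpose_mat A $$ (2, 3)"
    by (simp only: T)
  then show "(A * (B * C)) $$ (3, 0) = A $$ (3, 2) * B $$ (2, 1) * C $$ (1, 0)"
    using carrier \<open>3 < m\<close> by simp
qed

lemma smult_smult_mat: "x \<cdot>\<^sub>m (y \<cdot>\<^sub>m A) = (x * y) \<cdot>\<^sub>m (A :: complex mat)"
  by (rule eq_matI) (simp_all add: mult.assoc)

lemma one_smult_mat: "1 \<cdot>\<^sub>m A = (A :: complex mat)"
  by (rule eq_matI) simp_all

text \<open>For \<open>c = n\<close> the last equation restates \<open>(P T)\<^sup>3 = I\<close>.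
  The free scalar makes the situation stable under exchanging \<open>T\<close> and its inverse, see
  \<open>inverse_cube\<close>.\<close>

locale diagonal_cube =
  fixes m :: nat and P T T' :: "complex mat" and n c :: complex
  assumes carrier: "P \<in> carrier_mat m m" "T \<in> carrier_mat m m" "T' \<in> carrier_mat m m"
    and n_nonzero: "n \<noteq> 0" and c_nonzero: "c \<noteq> 0"
    and P_square: "P * P = n \<cdot>\<^sub>m 1\<^sub>m m"
    and TT': "T * T' = 1\<^sub>m m" and T'T: "T' * T = 1\<^sub>m m"
    and cube: "c \<cdot>\<^sub>m (P * (T * P)) = T' * (P * T')"
begin

lemmas [simp] = carrier mult_carrier_mat[of _ m m _ m] right_mult_one_mat[of _ m m] left_mult_one_mat[of _ m m]
lemmas assoc = assoc_mult_mat[of _ m m _ m _ m]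
lemmas smult_simps = mult_smult_assoc_mat[of _ m m _ m] mult_smult_distrib[of _ m m _ m]
  smult_smult_mat one_smult_mat

lemma cancel_simps:
  assumes "Z \<in> carrier_mat m m"
  shows "P * (P * Z) = n \<cdot>\<^sub>m Z" "T' * (T * Z) = Z" "T * (T' * Z) = Z"
  using assms by (simp_all add: assoc[symmetric] P_square T'T TT' smult_simps)

lemma inverse_cube: "diagonal_cube m P T' T n (1 / (c * n))"
proof
  have "T * ((c \<cdot>\<^sub>m (P * (T * P))) * T) = T * ((T' * (P * T')) * T)"
    by (simp only: cube)
  then have "c \<cdot>\<^sub>m (T * (P * (T * (P * T)))) = P"
    by (simp add: assoc smult_simps cancel_simps T'T)
  then have "P * (T' * P) = P * (T' * (c \<cdot>\<^sub>m (T * (P * (T * (P * T))))))"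
    by simp
  also have "\<dots> = (c * n) \<cdot>\<^sub>m (T * (P * T))"
    by (simp add: smult_simps cancel_simps)
  finally show "1 / (c * n) \<cdot>\<^sub>m (P * (T' * P)) = T * (P * T)"
    using n_nonzero c_nonzero by (simp add: smult_simps)
qed (use n_nonzero c_nonzero P_square TT' T'T in auto)

text \<open>By \<open>cube\<close> the claim concerns \<open>P * (T * P)\<close>: moving
  \<open>Y\<close> through it turns \<open>Y\<close> into \<open>X\<close>, passes \<open>T\<close>,
  and turns \<open>X\<close> back into \<open>Y\<close>.\<close>

lemma commute:
  assumes [simp]: "X \<in> carrier_mat m m" "Y \<in> carrier_mat m m"
    and "T * X = X * T" and PY: "P * Y = X * P" and YP: "Y * P = P * X"
  shows "(T' * (P * T')) * Y = Y * (T' * (P * T'))"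
proof -
  have TX: "T * (X * Z) = X * (T * Z)" if "Z \<in> carrier_mat m m" for Z
    using mult_mat_swap[OF assms(3), of m Z] that by simp
  have YP': "Y * (P * Z) = P * (X * Z)" if "Z \<in> carrier_mat m m" for Z
    using mult_mat_swap[OF YP, of m Z] that by simp
  show ?thesis
    unfolding cube[symmetric] by (simp add: assoc smult_simps PY TX YP')
qed

text \<open>Conjugation by \<open>T' P\<close> maps \<open>V\<close> to \<open>U\<close> and \<open>T' V T\<close> to \<open>V\<close>.\<close>

lemma transport_relation:
  assumes [simp]: "U \<in> carrier_mat m m" "V \<in> carrier_mat m m"
    and TU: "T * U = U * T" and PV: "P * V = U * P" and VP: "V * P = P * U"
    and rel: "U * (U * V) + \<beta> \<cdot>\<^sub>m (U * (V * U)) + V * (U * U) = \<omega> \<cdot>\<^sub>m U + \<eta> \<cdot>\<^sub>m 1\<^sub>m m"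
  defines "W \<equiv> T' * (V * T)"
  shows "V * (V * W) + \<beta> \<cdot>\<^sub>m (V * (W * V)) + W * (V * V) = \<omega> \<cdot>\<^sub>m V + \<eta> \<cdot>\<^sub>m 1\<^sub>m m"
    (is "?lhs = ?rhs")
proof -
  let ?G = "T' * P"
  have W [simp]: "W \<in> carrier_mat m m" by (simp add: W_def)
  have "T' * U = T' * (U * (T * T'))" by (simp add: TT')
  also have "\<dots> = T' * ((T * U) * T')" by (simp only: TU) (simp add: assoc)
  also have "\<dots> = U * T'" by (simp add: assoc cancel_simps)
  finally have T'U: "T' * U = U * T'" .
  have GV: "?G * V = U * ?G"
    using mult_mat_swap[OF T'U, of m P] by (simp add: assoc PV)
  have "?G * W = ((T' * (P * T')) * V) * T"
    by (simp add: W_def assoc)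
  also have "\<dots> = V * ?G"
    by (simp only: commute[OF assms(1,2) TU PV VP]) (simp add: assoc T'T)
  finally have GW: "?G * W = V * ?G" .
  have GVZ: "?G * (V * Z) = U * (?G * Z)" and GWZ: "?G * (W * Z) = V * (?G * Z)"
    if "Z \<in> carrier_mat m m" for Z
    using mult_mat_swap[OF GV, of m Z] mult_mat_swap[OF GW, of m Z] that by simp_all
  have [simp]: "?G \<in> carrier_mat m m" by simp
  define G where "G = ?G"
  have G [simp]: "G \<in> carrier_mat m m" by (simp add: G_def)
  note G_rules = GV[folded G_def] GW[folded G_def] GVZ[folded G_def] GWZ[folded G_def]
  have "G * ?lhs = (U * (U * V) + \<beta> \<cdot>\<^sub>m (U * (V * U)) + V * (U * U)) * G"
    by (simp add: mult_add_distrib_mat[of _ m m _ m] add_mult_distrib_mat[of _ m m _ _ m]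
        smult_simps assoc G_rules)
  also have "\<dots> = G * ?rhs"
    unfolding rel
    by (simp add: mult_add_distrib_mat[of _ m m _ m] add_mult_distrib_mat[of _ m m _ _ m]
        smult_simps G_rules)
  \<comment> \<open>The conjugating factor \<open>G\<close> is cancelled through
    \<open>P T T' P = n I\<close>.\<close>
  finally have "(P * T) * (G * ?lhs) = (P * T) * (G * ?rhs)" by simp
  moreover have "(P * T) * (G * Z) = n \<cdot>\<^sub>m Z" if "Z \<in> carrier_mat m m" for Z
    using that by (simp add: G_def assoc cancel_simps)
  ultimately have "n \<cdot>\<^sub>m ?lhs = n \<cdot>\<^sub>m ?rhs" by simp
  then have "(1 / n) \<cdot>\<^sub>m (n \<cdot>\<^sub>m ?lhs) = (1 / n) \<cdot>\<^sub>m (n \<cdot>\<^sub>m ?rhs)" by simp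
  then show ?thesis using n_nonzero by (simp add: smult_simps)
qed

end

lemmas [simp del] = index_mult_mat(1)

definition diagonal :: "nat \<Rightarrow> (nat \<Rightarrow> complex) \<Rightarrow> complex mat" where
  "diagonal m f = Matrix.mat m m (\<lambda>(i, j). if i = j then f i else 0)"

lemma diagonal_carrier [simp]: "diagonal m f \<in> carrier_mat m m"
  by (simp add: diagonal_def)

lemma index_diagonal [simp]:
  "i < m \<Longrightarrow> j < m \<Longrightarrow> diagonal m f $$ (i, j) = (if i = j then f i else 0)"
  by (simp add: diagonal_def)

lemma dim_diagonal [simp]: "dim_row (diagonal m f) = m" "dim_col (diagonal m f) = m"
  by (simp_all add: diagonal_def)

lemma index_diagonal_mult:
  assumes "A \<in> carrier_mat m m" "i < m" "j < m"
  shows "(diagonal m f * A) $$ (i, j) = f i * A $$ (i, j)"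
    and "(A * diagonal m f) $$ (i, j) = A $$ (i, j) * f j"
  using assms by (simp_all add: index_mult_mat_sum[of _ m] mult_delta_left mult_delta_right)

lemma diagonal_mult_diagonal: "diagonal m f * diagonal m g = diagonal m (\<lambda>i. f i * g i)"
  by (rule eq_matI) (simp_all add: index_diagonal_mult(1)[OF diagonal_carrier])

text \<open>The two sums give \<open>y * y = x * z\<close>, and then
  \<open>(x - q * y) * (q * x - y) = 0\<close>. In either case \<open>diff\<close> forces
  \<open>q\<^sup>2 = 1\<close>.\<close>

lemma no_common_ratio:
  fixes x y z q :: complex
  assumes "x \<noteq> 0" "y \<noteq> 0" "z \<noteq> 0" "q \<noteq> 0" "q\<^sup>2 \<noteq> 1" "q\<^sup>2 + 1 \<noteq> 0"
    and sum: "x + z = (q + 1 / q) * y" and inv: "1 / x + 1 / z = (q + 1 / q) * (1 / y)"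
    and diff: "y - 1 / y = (x - 1 / x) / q"
  shows False
proof -
  define \<beta> where "\<beta> = q + 1 / q"
  have \<beta>: "\<beta> \<noteq> 0" using assms(4,6) by (simp add: \<beta>_def field_simps power2_eq_square)
  have "(x + z) * y = \<beta> * (x * z)"
    using inv[folded \<beta>_def] assms(1-3) by (simp add: field_simps)
  then have "\<beta> * (y * y) = \<beta> * (x * z)" by (simp add: sum[folded \<beta>_def] mult.assoc)
  then have yy: "y * y = x * z" using \<beta> by simp
  have "x * (x + z) = \<beta> * (x * y)" by (simp add: sum[folded \<beta>_def])
  then have "x * x + y * y = (q + 1 / q) * (x * y)" by (simp add: yy distrib_left \<beta>_def)
  then have "(x - q * y) * (q * x - y) = 0" using assms(4) by (simp add: field_simps)
  then consider "x = q * y" | "y = q * x" by auto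
  then show False
  proof cases
    case 1
    then have "y - 1 / y = y - 1 / (q\<^sup>2 * y)"
      using diff assms(2,4) by (simp add: field_simps power2_eq_square)
    then show False using assms(2,4,5) by (simp add: field_simps)
  next
    case 2
    then have "q * x - 1 / (q * x) = x / q - 1 / (q * x)"
      using diff by (simp add: diff_divide_distrib mult.commute)
    then show False using assms(1,4,5) by (simp add: field_simps power2_eq_square)
  qed
qed

section \<open>The relations between consecutive diagonal entries of \<open>T\<close>\<close>

context bilinear_eigenmatrix
begin

definition m :: nat where "m = D + 1"

lemma less_m_iff: "i < m \<longleftrightarrow> i \<le> D" and lessThan_m: "{..<m} = {..D}"
  by (auto simp: m_def)

lemma m_gt_3: "3 < m"
  using min_gt_2 by (auto simp: m_def)

definition Pm :: "complex mat" where "Pm = Matrix.mat m m (\<lambda>(i, j). P i j)"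
definition Lm :: "complex mat" where "Lm = Matrix.mat m m (\<lambda>(i, j). L i j)"

lemma Pm_Lm_carrier [simp]: "Pm \<in> carrier_mat m m" "Lm \<in> carrier_mat m m"
  by (simp_all add: Pm_def Lm_def)

lemma dim_Pm_Lm [simp]: "dim_row Pm = m" "dim_col Pm = m" "dim_row Lm = m" "dim_col Lm = m"
  by (simp_all add: Pm_def Lm_def)

lemma index_Pm_Lm [simp]:
  "i < m \<Longrightarrow> j < m \<Longrightarrow> Pm $$ (i, j) = P i j" "i < m \<Longrightarrow> j < m \<Longrightarrow> Lm $$ (i, j) = L i j"
  by (simp_all add: Pm_def Lm_def)

lemma Pm_square: "Pm * Pm = n \<cdot>\<^sub>m 1\<^sub>m m"
proof (rule eq_matI)
  fix i j assume "i < dim_row (n \<cdot>\<^sub>m 1\<^sub>m m)" "j < dim_col (n \<cdot>\<^sub>m 1\<^sub>m m)"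
  then have ij: "i < m" "j < m" by simp_all
  then have "(Pm * Pm) $$ (i, j) = (\<Sum>k<m. P i k * P k j)"
    by (simp add: index_mult_mat_sum[of _ m])
  also have "\<dots> = (if i = j then n else 0)"
    using P_square[of i j] ij by (simp only: less_m_iff lessThan_m)
  finally show "(Pm * Pm) $$ (i, j) = (n \<cdot>\<^sub>m 1\<^sub>m m) $$ (i, j)"
    using ij by simp
qed simp_all

lemma Pm_Lm: "Pm * Lm = diagonal m \<theta> * Pm"
proof (rule eq_matI)
  fix i j assume "i < dim_row (diagonal m \<theta> * Pm)" "j < dim_col (diagonal m \<theta> * Pm)"
  then have ij: "i < m" "j < m" by simp_all
  then have "(Pm * Lm) $$ (i, j) = (\<Sum>k<m. P i k * L k j)"
    by (simp add: index_mult_mat_sum[of _ m])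
  also have "\<dots> = \<theta> i * P i j"
    using P_mult_L[of i j] P_one[of i] ij by (simp only: less_m_iff lessThan_m)
  finally show "(Pm * Lm) $$ (i, j) = (diagonal m \<theta> * Pm) $$ (i, j)"
    using ij by (simp add: index_diagonal_mult)
qed simp_all

lemma Lm_Pm: "Lm * Pm = Pm * diagonal m \<theta>"
proof (rule eq_matI)
  fix i j assume "i < dim_row (Pm * diagonal m \<theta>)" "j < dim_col (Pm * diagonal m \<theta>)"
  then have ij: "i < m" "j < m" by simp_all
  then have "(Lm * Pm) $$ (i, j) = (\<Sum>k<m. L i k * P k j)"
    by (simp add: index_mult_mat_sum[of _ m])
  also have "\<dots> = \<theta> j * P i j"
    using L_mult_P[of i j] P_one[of j] ij by (simp only: less_m_iff lessThan_m)
  finally show "(Lm * Pm) $$ (i, j) = (Pm * diagonal m \<theta>) $$ (i, j)"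
    using ij by (simp add: index_diagonal_mult mult.commute)
qed simp_all

text \<open>The entry \<open>(1, 0)\<close> of \<open>S L = L S\<close> with \<open>S = T' P T'\<close>.\<close>

lemma diagonal_cube_first_relation:
  assumes "diagonal_cube m Pm (diagonal m t) (diagonal m s) n c'"
  shows "s 0 * s 0 + a 1 * (s 1 * s 0) + b 1 * (s 2 * s 0) = \<theta> 1 * (s 1 * s 1)"
proof -
  interpret diagonal_cube m Pm "diagonal m t" "diagonal m s" n c' by fact
  let ?S = "diagonal m s * (Pm * diagonal m s)"
  have S: "?S $$ (i, j) = s i * P i j * s j" if "i < m" "j < m" for i j
    using that by (simp add: index_diagonal_mult)
  have D2: "0 < m" "1 < m" "2 < m" using m_gt_3 by auto
  have P_first: "P 1 1 = \<theta> 1" "P 0 0 = 1" "P 1 0 = 1" "P 2 0 = 1"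
    using P_one[of 1] P_zero[of 0] P_zero[of 1] P_zero[of 2] min_gt_2 by auto
  have "diagonal m t * diagonal m \<theta> = diagonal m \<theta> * diagonal m t"
    by (simp add: diagonal_mult_diagonal mult.commute)
  then have "?S * Lm = Lm * ?S"
    by (intro commute[where X = "diagonal m \<theta>"] Pm_Lm Lm_Pm) simp_all
  \<comment> \<open>Column 0 of \<open>L\<close> has the single nonzero entry
    \<open>c 1 = 1\<close>, because \<open>a 0 = 0\<close>.\<close>
  moreover have "(?S * Lm) $$ (1, 0) = ?S $$ (1, 1)"
  proof -
    have "(?S * Lm) $$ (1, 0) = (\<Sum>k<m. ?S $$ (1, k) * Lm $$ (k, 0))"
      using D2 by (intro index_mult_mat_sum) simp_all
    also have "\<dots> = (\<Sum>k<m. if k = 1 then ?S $$ (1, 1) else 0)"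
      using D2 by (intro sum.cong refl) (auto simp: L_def a_0 c_1)
    finally show ?thesis using D2 by simp
  qed
  moreover have "(Lm * ?S) $$ (1, 0) = (\<Sum>k<m. L 1 k * ?S $$ (k, 0))"
    using D2 index_mult_mat_sum[of Lm m ?S 1 0] by simp
  ultimately have "?S $$ (1, 1) = (\<Sum>k<m. L 1 k * ?S $$ (k, 0))"
    using D2 by simp
  also have "\<dots> = c 1 * ?S $$ (0, 0) + a 1 * ?S $$ (1, 0) + b 1 * ?S $$ (2, 0)"
    using L_row_sum[of 1 "\<lambda>k. ?S $$ (k, 0)"] D2
    by (simp only: less_m_iff lessThan_m numeral_2_eq_2 One_nat_def diff_self_eq_0)
  finally show ?thesis
    using D2 P_first by (simp add: S c_1 mult_ac)
qed

text \<open>The source of the factor \<open>1 / Q\<close> between the first two ratios.\<close>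

lemma \<theta>_1_plus_1: "1 + \<theta> 1 = b 1 / Q"
  using Q_nonzero Q_neq_1 by (simp add: \<theta>_def b_def divide_simps) (simp add: algebra_simps)

text \<open>An affine normalisation of \<open>\<theta>\<close> to pure powers of
  \<open>1 / Q\<close>; \<open>V\<close> is the same affine image of \<open>L\<close>, so
  \<open>P\<close> still intertwines the two.\<close>

definition U :: "complex mat" where "U = diagonal m (\<lambda>i. 1 / Q ^ i)"

definition V :: "complex mat" where
  "V = ((Q - 1) / (Q ^ M * Q ^ N)) \<cdot>\<^sub>m Lm + (- (1 - Q ^ M - Q ^ N) / (Q ^ M * Q ^ N)) \<cdot>\<^sub>m 1\<^sub>m m"

lemma U_V_carrier [simp]: "U \<in> carrier_mat m m" "V \<in> carrier_mat m m"
  by (simp_all add: U_def V_def)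

lemma dim_U_V [simp]: "dim_row U = m" "dim_col U = m" "dim_row V = m" "dim_col V = m"
  by (simp_all add: U_def V_def)

lemma U_eq: "U = ((Q - 1) / (Q ^ M * Q ^ N)) \<cdot>\<^sub>m diagonal m \<theta>
    + (- (1 - Q ^ M - Q ^ N) / (Q ^ M * Q ^ N)) \<cdot>\<^sub>m 1\<^sub>m m"
  by (rule eq_matI)
    (use Q_nonzero Q_neq_1 in \<open>simp_all add: U_def \<theta>_def divide_simps, simp add: algebra_simps\<close>)

lemma Pm_V: "Pm * V = U * Pm" and V_Pm: "V * Pm = Pm * U"
  unfolding U_eq V_def
  by (simp_all add: mult_add_distrib_mat[of _ m m _ m] add_mult_distrib_mat[of _ m m _ _ m]
      mult_smult_assoc_mat[of _ m m _ m] mult_smult_distrib[of _ m m _ m] Pm_Lm Lm_Pm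
      right_mult_one_mat[of _ m m] left_mult_one_mat[of _ m m])

lemma index_V:
  assumes "i < m" "j < m"
  shows "V $$ (i, j) = (Q - 1) / (Q ^ M * Q ^ N) * L i j
    + (if i = j then - (1 - Q ^ M - Q ^ N) / (Q ^ M * Q ^ N) else 0)"
  using assms by (simp add: V_def)

text \<open>Entry \<open>(i, j)\<close> of \<open>V\<close> is multiplied by
  \<open>(u - Q * v) * (u - v / Q)\<close> with \<open>u = 1 / Q ^ i\<close> and
  \<open>v = 1 / Q ^ j\<close>, which vanishes for neighbouring indices. The diagonal entries of
  \<open>V\<close> are quadratic in \<open>Q ^ j\<close> without constant term, so the diagonal of
  the result is affine in \<open>1 / Q ^ j\<close>.\<close>

lemma Askey_Wilson_relation:
  obtains \<omega> \<eta> where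
    "U * (U * V) + (- (Q + 1 / Q)) \<cdot>\<^sub>m (U * (V * U)) + V * (U * U) = \<omega> \<cdot>\<^sub>m U + \<eta> \<cdot>\<^sub>m 1\<^sub>m m"
proof
  define d e where "d = Q ^ M" and "e = Q ^ N"
  have de: "d \<noteq> 0" "e \<noteq> 0" using Q_nonzero by (simp_all add: d_def e_def)
  define \<omega> where "\<omega> = (2 - (Q + 1 / Q)) * (d + e + 1 / Q) / (d * e)"
  define \<eta> where "\<eta> = - ((2 - (Q + 1 / Q)) * (1 + 1 / Q)) / (d * e)"
  show "U * (U * V) + (- (Q + 1 / Q)) \<cdot>\<^sub>m (U * (V * U)) + V * (U * U) = \<omega> \<cdot>\<^sub>m U + \<eta> \<cdot>\<^sub>m 1\<^sub>m m"
  proof (rule eq_matI)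
    fix i j assume "i < dim_row (\<omega> \<cdot>\<^sub>m U + \<eta> \<cdot>\<^sub>m 1\<^sub>m m)" "j < dim_col (\<omega> \<cdot>\<^sub>m U + \<eta> \<cdot>\<^sub>m 1\<^sub>m m)"
    then have ij: "i < m" "j < m" by simp_all
    have UU: "(V * (U * U)) $$ (i, j) = V $$ (i, j) * (1 / Q ^ j * (1 / Q ^ j))"
      using ij by (simp add: U_def diagonal_mult_diagonal index_diagonal_mult)
    have "(U * (U * V) + (- (Q + 1 / Q)) \<cdot>\<^sub>m (U * (V * U)) + V * (U * U)) $$ (i, j) =
        (U * (U * V)) $$ (i, j) - (Q + 1 / Q) * (U * (V * U)) $$ (i, j) + (V * (U * U)) $$ (i, j)"
      using ij by (simp add: algebra_simps)
    also have "\<dots> = (1 / Q ^ i * (1 / Q ^ i) - (Q + 1 / Q) * (1 / Q ^ i * (1 / Q ^ j)) + 1 / Q ^ j * (1 / Q ^ j)) * V $$ (i, j)"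
      unfolding UU using ij by (simp add: U_def index_diagonal_mult[of _ m]
          mult_carrier_mat[of _ m m _ m] algebra_simps)
    also have "\<dots> = (if i = j then \<omega> * (1 / Q ^ i) + \<eta> else 0)"
    proof -
      consider "i = j" | "j = Suc i" | "i = Suc j" | "j \<noteq> Suc i" "i \<noteq> Suc j" "i \<noteq> j" by blast
      then show ?thesis
      proof cases
        case 1
        define x where "x = Q ^ j"
        have x: "x \<noteq> 0" using Q_nonzero by (simp add: x_def)
        have V: "V $$ (j, j) = ((d + e + 1 / Q) * x - (1 + 1 / Q) * x\<^sup>2) / (d * e)"
          using ij Q_nonzero Q_neq_1 de
          unfolding index_V[OF ij(2) ij(2)]
          by (simp add: L_def a_def b_def c_def d_def[symmetric] e_def[symmetric] x_def[symmetric] divide_simps)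
            (simp add: algebra_simps power2_eq_square)
        show ?thesis
          unfolding 1 V x_def[symmetric] \<omega>_def \<eta>_def using x Q_nonzero de
          by (simp add: divide_simps) (simp add: algebra_simps power2_eq_square)
      next
        case 2
        then show ?thesis using Q_nonzero by (simp add: divide_simps)
      next
        case 3
        then show ?thesis using Q_nonzero by (simp add: divide_simps)
      next
        case 4
        then have "V $$ (i, j) = 0" using ij by (simp add: index_V L_def)
        then show ?thesis using 4 by simp
      qed
    qed
    also have "\<dots> = (\<omega> \<cdot>\<^sub>m U + \<eta> \<cdot>\<^sub>m 1\<^sub>m m) $$ (i, j)"
      using ij by (simp add: U_def)
    finally show "(U * (U * V) + (- (Q + 1 / Q)) \<cdot>\<^sub>m (U * (V * U)) + V * (U * U)) $$ (i, j) =
        (\<omega> \<cdot>\<^sub>m U + \<eta> \<cdot>\<^sub>m 1\<^sub>m m) $$ (i, j)" .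
  qed simp_all
qed

text \<open>At the corners \<open>(0, 3)\<close> and \<open>(3, 0)\<close> the right side of the
  transported relation is zero, and the three triple products share the same three nonzero entries
  of \<open>V\<close>, which cancel.\<close>

lemma diagonal_cube_recurrence:
  assumes cube: "diagonal_cube m Pm (diagonal m t) (diagonal m s) n c'"
  shows "s 2 * t 3 - (Q + 1 / Q) * (s 1 * t 2) + s 0 * t 1 = 0"
    and "s 1 * t 0 - (Q + 1 / Q) * (s 2 * t 1) + s 3 * t 2 = 0"
proof -
  have bc: "b i \<noteq> 0" "c (Suc i) \<noteq> 0" if "i < 3" for i
    using that b_nonzero[of i] c_nonzero[of "Suc i"] min_gt_2 by simp_all
  interpret diagonal_cube m Pm "diagonal m t" "diagonal m s" n c' by fact
  define W where "W = diagonal m s * (V * diagonal m t)"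
  have W [simp]: "W \<in> carrier_mat m m" by (simp add: W_def)
  have D3: "3 < m" by (rule m_gt_3)
  have index_W: "W $$ (i, j) = s i * V $$ (i, j) * t j" if "i < m" "j < m" for i j
    using that by (simp add: W_def index_diagonal_mult)
  have V0: "V $$ (i, j) = 0" if "i < m" "j < m" "i + 1 < j \<or> j + 1 < i" for i j
    using that by (auto simp: index_V L_def)
  have W0: "W $$ (i, j) = 0" if "i < m" "j < m" "i + 1 < j \<or> j + 1 < i" for i j
    using that by (simp add: index_W V0)
  obtain \<omega> \<eta> where AW:
    "U * (U * V) + (- (Q + 1 / Q)) \<cdot>\<^sub>m (U * (V * U)) + V * (U * U) = \<omega> \<cdot>\<^sub>m U + \<eta> \<cdot>\<^sub>m 1\<^sub>m m"
    by (rule Askey_Wilson_relation)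
  have "diagonal m t * U = U * diagonal m t"
    by (simp add: U_def diagonal_mult_diagonal mult.commute)
  then have "V * (V * W) + (- (Q + 1 / Q)) \<cdot>\<^sub>m (V * (W * V)) + W * (V * V) = \<omega> \<cdot>\<^sub>m V + \<eta> \<cdot>\<^sub>m 1\<^sub>m m"
    unfolding W_def by (intro transport_relation[OF _ _ _ Pm_V V_Pm AW]) simp_all
  then have entry: "(V * (V * W) + (- (Q + 1 / Q)) \<cdot>\<^sub>m (V * (W * V)) + W * (V * V)) $$ (i, j)
      = (\<omega> \<cdot>\<^sub>m V + \<eta> \<cdot>\<^sub>m 1\<^sub>m m) $$ (i, j)" for i j
    by (simp only:)
  have entry: "(V * (V * W)) $$ (i, j) - (Q + 1 / Q) * (V * (W * V)) $$ (i, j) + (W * (V * V)) $$ (i, j) = 0"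
    if "(i, j) = (0, 3) \<or> (i, j) = (3, 0)" for i j
  proof -
    have ij: "i < m" "j < m" using that D3 by auto
    have "(\<omega> \<cdot>\<^sub>m V + \<eta> \<cdot>\<^sub>m 1\<^sub>m m) $$ (i, j) = 0"
      using ij that V0[OF ij] by auto
    then show ?thesis using entry[of i j] ij carrier_matD[OF W] by (simp add: algebra_simps)
  qed
  note triple = index_triple_mult_tridiagonal[OF _ _ _ D3]
  have VVW: "(V * (V * W)) $$ (0, 3) = V $$ (0, 1) * V $$ (1, 2) * W $$ (2, 3)"
    "(V * (V * W)) $$ (3, 0) = V $$ (3, 2) * V $$ (2, 1) * W $$ (1, 0)"
    by (rule triple; auto simp: V0 W0)+
  have VWV: "(V * (W * V)) $$ (0, 3) = V $$ (0, 1) * W $$ (1, 2) * V $$ (2, 3)"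
    "(V * (W * V)) $$ (3, 0) = V $$ (3, 2) * W $$ (2, 1) * V $$ (1, 0)"
    by (rule triple; auto simp: V0 W0)+
  have WVV: "(W * (V * V)) $$ (0, 3) = W $$ (0, 1) * V $$ (1, 2) * V $$ (2, 3)"
    "(W * (V * V)) $$ (3, 0) = W $$ (3, 2) * V $$ (2, 1) * V $$ (1, 0)"
    by (rule triple; auto simp: V0 W0)+
  have nz: "V $$ (0, 1) \<noteq> 0" "V $$ (1, 2) \<noteq> 0" "V $$ (2, 3) \<noteq> 0"
    "V $$ (1, 0) \<noteq> 0" "V $$ (2, 1) \<noteq> 0" "V $$ (3, 2) \<noteq> 0"
    using D3 Q_nonzero Q_neq_1 bc[of 0] bc[of 1] bc[of 2]
    by (simp_all add: index_V L_def numeral_2_eq_2 numeral_3_eq_3)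
  have "V $$ (0, 1) * V $$ (1, 2) * V $$ (2, 3) * (s 2 * t 3 - (Q + 1 / Q) * (s 1 * t 2) + s 0 * t 1)
      = (V * (V * W)) $$ (0, 3) - (Q + 1 / Q) * (V * (W * V)) $$ (0, 3) + (W * (V * V)) $$ (0, 3)"
    unfolding VVW VWV WVV using D3 by (simp add: index_W algebra_simps)
  then show "s 2 * t 3 - (Q + 1 / Q) * (s 1 * t 2) + s 0 * t 1 = 0"
    using entry[of 0 3] nz by simp
  have "V $$ (3, 2) * V $$ (2, 1) * V $$ (1, 0) * (s 1 * t 0 - (Q + 1 / Q) * (s 2 * t 1) + s 3 * t 2)
      = (V * (V * W)) $$ (3, 0) - (Q + 1 / Q) * (V * (W * V)) $$ (3, 0) + (W * (V * V)) $$ (3, 0)"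
    unfolding VVW VWV WVV using D3 by (simp add: index_W algebra_simps)
  then show "s 1 * t 0 - (Q + 1 / Q) * (s 2 * t 1) + s 3 * t 2 = 0"
    using entry[of 3 0] nz by simp
qed

text \<open>Subtracting the first relation from its version for the exchanged pair cancels
  \<open>a 1\<close> and gives
  \<open>b 1 * (y - 1 / y) = (1 + \<theta> 1) * (x - 1 / x)\<close>.\<close>

lemma no_diagonal_cube:
  assumes cube: "diagonal_cube m Pm (diagonal m t) (diagonal m (\<lambda>i. 1 / t i)) n c'"
    and t: "\<And>i. i \<le> D \<Longrightarrow> t i \<noteq> 0"
  shows False
proof -
  define x y z where "x = t 1 / t 0" and "y = t 2 / t 1" and "z = t 3 / t 2"
  have t': "t 0 \<noteq> 0" "t 1 \<noteq> 0" "t 2 \<noteq> 0" "t 3 \<noteq> 0" using t min_gt_2 by auto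
  have b1: "b 1 \<noteq> 0" using b_nonzero[of 1] min_gt_2 by simp
  have "x + a 1 + b 1 / y = \<theta> 1 / x"
    using diagonal_cube_first_relation[OF cube] t'
    by (simp add: x_def y_def divide_simps) (simp add: algebra_simps)
  moreover have "1 / x + a 1 + b 1 * y = \<theta> 1 * x"
    using diagonal_cube_first_relation[OF diagonal_cube.inverse_cube[OF cube]] t'
    by (simp add: x_def y_def field_simps)
  moreover have "b 1 * (y - 1 / y) = (1 / x + a 1 + b 1 * y) - (x + a 1 + b 1 / y) + (x - 1 / x)"
    by (simp add: algebra_simps)
  ultimately have "b 1 * (y - 1 / y) = \<theta> 1 * x - \<theta> 1 / x + (x - 1 / x)"
    by (simp only:)
  also have "\<dots> = (1 + \<theta> 1) * (x - 1 / x)"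
    by (simp add: algebra_simps)
  finally have "y - 1 / y = (x - 1 / x) / Q"
    unfolding \<theta>_1_plus_1 using b1 by (metis mult_left_cancel times_divide_eq_left times_divide_eq_right)
  moreover have "x + z = (Q + 1 / Q) * y" "1 / x + 1 / z = (Q + 1 / Q) * (1 / y)"
    using diagonal_cube_recurrence[OF cube] by (simp_all add: x_def y_def z_def algebra_simps)
  moreover have "Q\<^sup>2 \<noteq> 1" using Q_power_eq_iff[of 2 0] by simp
  moreover have "Q\<^sup>2 + 1 \<noteq> 0"
    by (metis of_nat_power of_nat_Suc of_nat_neq_0 add.commute)
  ultimately show False
    using no_common_ratio[of x y z Q] t' Q_nonzero by (auto simp: x_def y_def z_def)
qed

end

theorem theorem3:
  fixes M N :: nat
    and E :: "nat \<Rightarrow> complex^('f::{field,finite}^'n^'m)^('f^'n^'m)"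
    and P :: "complex Matrix.mat"
  assumes "M = CARD('m)" and "N = CARD('n)"
    and "min M N > 2"
    and "self_dual_eigenmatrix (min M N) bilinear_rel E P"
  shows "\<not> (\<exists>T \<in> carrier_mat (min M N + 1) (min M N + 1).
           diagonal_mat T \<and> (P * T) ^\<^sub>m 3 = 1\<^sub>m (min M N + 1))"
proof
  assume "\<exists>T \<in> carrier_mat (min M N + 1) (min M N + 1).
      diagonal_mat T \<and> (P * T) ^\<^sub>m 3 = 1\<^sub>m (min M N + 1)"
  then obtain T where T_carrier: "T \<in> carrier_mat (min M N + 1) (min M N + 1)"
    and T_diag: "diagonal_mat T" and cube: "(P * T) ^\<^sub>m 3 = 1\<^sub>m (min M N + 1)"
    by blast
  have D: "min M N = min CARD('m) CARD('n)" by (simp add: assms(1,2))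
  define p where "p = (\<lambda>i j. P $$ (i, j))"
  interpret self_dual_P_polynomial "min CARD('m) CARD('n)" "\<lambda>i. adjacency (bilinear_rel i)" E
    "bilinear_parameters.L CARD('f) CARD('m) CARD('n)" p "of_nat CARD('f^'n^'m)"
    using bilinear_self_dual_P_polynomial[of E P] assms(3,4) unfolding D p_def by blast
  interpret bilinear_eigenmatrix "CARD('f)" "CARD('m)" "CARD('n)" p "of_nat CARD('f^'n^'m)"
    using assms(3) card_field_gt_one P_zero P_square P_mult_L n_nonzero unfolding D
    by unfold_locales auto
  have m: "min M N + 1 = m" by (simp add: m_def D)
  define t where "t i = T $$ (i, i)" for i
  have "P \<in> carrier_mat m m"
    using assms(4) by (simp add: m self_dual_eigenmatrix_def first_eigenmatrix_def flip: m)
  moreover have "p i j = P $$ (i, j)" for i j by (simp add: p_def)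
  ultimately have P: "P = Pm" by (intro eq_matI) (auto simp: Pm_def)
  have T: "T = diagonal m t"
    using T_carrier[unfolded m] T_diag by (intro eq_matI) (auto simp: t_def diagonal_mat_def)
  have [simp]: "Pm * X \<in> carrier_mat m m" "diagonal m f * X \<in> carrier_mat m m"
    if "X \<in> carrier_mat m m" for X f
    using that by (auto intro: mult_carrier_mat[of _ m m _ m])
  let ?T = "diagonal m t"
  have *: "Pm * (?T * (Pm * (?T * (Pm * ?T)))) = 1\<^sub>m m"
    using cube unfolding P T m
    by (simp add: numeral_3_eq_3 assoc_mult_mat[of _ m m _ m _ m] left_mult_one_mat[of _ m m])
  let ?n = "of_nat CARD('f^'n^'m) :: complex"
  have PP: "Pm * (Pm * X) = ?n \<cdot>\<^sub>m X" if "X \<in> carrier_mat m m" for X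
    using that assoc_mult_mat[of Pm m m Pm m X m]
    by (simp add: Pm_square mult_smult_assoc_mat[of _ m m _ m] left_mult_one_mat[of _ m m])
  have "Pm * (Pm * (?T * (Pm * (?T * (Pm * ?T))))) = Pm"
    by (simp add: * right_mult_one_mat[of _ m m])
  then have TPT: "?n \<cdot>\<^sub>m (?T * (Pm * (?T * (Pm * ?T)))) = Pm"
    by (simp add: PP)
  \<comment> \<open>A zero entry of \<open>T\<close> would make a row of \<open>Pm\<close> vanish by
    \<open>TPT\<close>, but column 0 of \<open>Pm\<close> consists of ones.\<close>
  have t: "t i \<noteq> 0" if "i < m" for i
  proof
    assume "t i = 0"
    then have "(?n \<cdot>\<^sub>m (?T * (Pm * (?T * (Pm * ?T))))) $$ (i, 0) = 0"
      using that m_gt_3 by (simp add: index_diagonal_mult[of _ m])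
    moreover have "Pm $$ (i, 0) = 1" using that m_gt_3 P_zero[of i] by (simp add: less_m_iff)
    ultimately show False using TPT by simp
  qed
  let ?S = "diagonal m (\<lambda>i. 1 / t i)"
  have inv: "?T * ?S = 1\<^sub>m m" "?S * ?T = 1\<^sub>m m"
    unfolding diagonal_mult_diagonal by (rule eq_matI; use t in simp)+
  have "diagonal_cube m Pm ?T ?S ?n ?n"
  proof
    have "?S * (Pm * ?S) = ?S * ((?n \<cdot>\<^sub>m (?T * (Pm * (?T * (Pm * ?T))))) * ?S)"
      by (simp only: TPT)
    also have "\<dots> = ?n \<cdot>\<^sub>m ((?S * ?T) * (Pm * (?T * (Pm * (?T * ?S)))))"
      by (simp add: mult_smult_assoc_mat[of _ m m _ m] mult_smult_distrib[of _ m m _ m]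
          assoc_mult_mat[of _ m m _ m _ m])
    finally show "?n \<cdot>\<^sub>m (Pm * (?T * Pm)) = ?S * (Pm * ?S)"
      by (simp add: inv left_mult_one_mat[of _ m m] right_mult_one_mat[of _ m m])
  qed (use inv Pm_square n_nonzero in simp_all)
  then show False
    by (rule no_diagonal_cube) (use t in \<open>simp add: less_m_iff\<close>)
qed

end
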